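(* Let $n\ge1$ and $1\le k\le n$. Then the Olshanski decomposition of $\mathbf{H}_k(n+1)$ is $$\mathbf{H}_k(n+1)=\mathbf{H}_k(n)\dotplus\mathbf{H}_k(n+1)^0,$$ where $\mathbf{H}_k(n+1)^0=\mathbf{H}_k(n+1)-\mathbf{H}_k(n)\in\mathbf{I}(n+1)^0$ and $\mathbf{H}_k(n)\in\boldsymbol\zeta(n)$.
   Context: $\boldsymbol\zeta(n)$ is the center of $\mathbf{U}(gl(n))$, $gl(n)=gl(n,\mathbb C)$ with standard basis $e_{i,j}$; $\mathbf{U}(gl(n))\subset\mathbf{U}(gl(n+1))$ via $e_{i,j}\mapsto e_{i,j}$. For a matrix with noncommuting entries, $\mathbf{cdet}(A)=\sum_\sigma(-1)^{|\sigma|}a_{\sigma(1),1}\cdots a_{\sigma(k),k}$, and for $1\le k\le n$ $$\mathbf{H}_k(n)=\sum_{1\le i_1<\cdots<i_k\le n}\mathbf{cdet}\big[e_{i_a,i_b}+\delta_{ab}(k-a)\big]_{a,b=1,\dots,k}.$$ Olshanski decomposition: let $\mathbf{U}(gl(n+1))^0$ be the centralizer of $e_{n+1,n+1}$ in $\mathbf{U}(gl(n+1))$, let $\mathbf{I}(n+1)$ be the left ideal of $\mathbf{U}(gl(n+1))$ generated by $e_{i,n+1}$, $i=1,\dots,n+1$, and let $\mathbf{I}(n+1)^0=\mathbf{I}(n+1)\cap\mathbf{U}(gl(n+1))^0$, a two-sided ideal of $\mathbf{U}(gl(n+1))^0$. One has $\mathbf{U}(gl(n+1))^0=\mathbf{U}(gl(n))\oplus\mathbf{I}(n+1)^0$,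 and every $\boldsymbol\varrho\in\boldsymbol\zeta(n+1)$ has a unique decomposition $\boldsymbol\varrho=\boldsymbol\varrho'\dotplus\boldsymbol\varrho^0$ with $\boldsymbol\varrho'\in\boldsymbol\zeta(n)$, $\boldsymbol\varrho^0\in\mathbf{I}(n+1)^0$, called its Olshanski decomposition. *)

theory Defs
  imports Complex_Main "HOL-Library.Poly_Mapping" "HOL-Combinatorics.Permutations" "HOL-Algebra.QuotRing"
begin

section \<open>The free algebra on the matrix units\<close>

text \<open>Words form a monoid under concatenation, written additively so that
  \<open>'a word \<Rightarrow>\<^sub>0 complex\<close>, with the convolution product of
  \<^theory>\<open>HOL-Library.Poly_Mapping\<close>, is the free associative unital complex algebra on \<open>'a\<close>.\<close>

datatype 'a word = Word (letters: "'a list")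

instantiation word :: (type) monoid_add
begin

definition zero_word :: "'a word" where "0 = Word []"

definition plus_word :: "'a word \<Rightarrow> 'a word \<Rightarrow> 'a word"
  where "u + v = Word (letters u @ letters v)"

instance by standard (simp_all add: zero_word_def plus_word_def)

end

type_synonym free_alg = "(nat \<times> nat) word \<Rightarrow>\<^sub>0 complex"

definition free_gen :: "nat \<Rightarrow> nat \<Rightarrow> free_alg"
  where "free_gen i j = Poly_Mapping.single (Word [(i, j)]) 1"

text \<open>The tensor algebra of the vector space \<open>gl(n, \<complex>)\<close>, i.e. the free algebra on the basis
  \<open>e\<^bsub>i,j\<^esub>\<close>, \<open>1 \<le> i, j \<le> n\<close>.\<close>

definition tensor_gl :: "nat \<Rightarrow> free_alg ring"
  where "tensor_gl n =
    \<lparr>carrier = {f. \<forall>w \<in> Poly_Mapping.keys f. set (letters w) \<subseteq> {1..n} \<times> {1..n}},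
     monoid.mult = (*), one = 1, zero = 0, add = (+)\<rparr>"

section \<open>The enveloping algebra \<open>U(gl(n))\<close>\<close>

text \<open>The elements \<open>x y - y x - [x, y]\<close> for \<open>x, y\<close> in the standard basis, where
  \<open>[e\<^bsub>i,j\<^esub>, e\<^bsub>k,l\<^esub>] = \<delta>\<^bsub>j,k\<^esub> e\<^bsub>i,l\<^esub> - \<delta>\<^bsub>l,i\<^esub> e\<^bsub>k,j\<^esub>\<close>.\<close>

definition gl_relations :: "nat \<Rightarrow> free_alg set"
  where "gl_relations n =
    {free_gen i j * free_gen k l - free_gen k l * free_gen i j
       - ((if j = k then free_gen i l else 0) - (if l = i then free_gen k j else 0)) | i j k l.
     i \<in> {1..n} \<and> j \<in> {1..n} \<and> k \<in> {1..n} \<and> l \<in> {1..n}}"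

definition gl_ideal :: "nat \<Rightarrow> free_alg set"
  where "gl_ideal n = Idl\<^bsub>tensor_gl n\<^esub> gl_relations n"

definition Ugl :: "nat \<Rightarrow> free_alg set ring"
  where "Ugl n = tensor_gl n Quot gl_ideal n"

definition e_gl :: "nat \<Rightarrow> nat \<Rightarrow> nat \<Rightarrow> free_alg set"
  where "e_gl n i j = gl_ideal n +>\<^bsub>tensor_gl n\<^esub> free_gen i j"

text \<open>The inclusion \<open>U(gl(n)) \<rightarrow> U(gl(n+1))\<close>, \<open>e\<^bsub>i,j\<^esub> \<mapsto> e\<^bsub>i,j\<^esub>\<close>. On residue classes it sends
  \<open>J(n) + x\<close> to \<open>J(n+1) + (J(n) + x) = J(n+1) + x\<close>, because \<open>J(n) \<subseteq> J(n+1)\<close>; see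
  \<open>Ugl_incl_coset\<close>, \<open>Ugl_incl_hom\<close> and \<open>Ugl_incl_e_gl\<close> below.\<close>

definition Ugl_incl :: "nat \<Rightarrow> free_alg set \<Rightarrow> free_alg set"
  where "Ugl_incl n X = gl_ideal (n + 1) <+>\<^bsub>tensor_gl (n + 1)\<^esub> X"

section \<open>Centralizers, left ideals and column determinants in a ring\<close>

definition ring_centralizer :: "('a, 'b) ring_scheme \<Rightarrow> 'a set \<Rightarrow> 'a set"
  where "ring_centralizer R S =
    {z \<in> carrier R. \<forall>x \<in> S. z \<otimes>\<^bsub>R\<^esub> x = x \<otimes>\<^bsub>R\<^esub> z}"

definition left_ideal :: "'a set \<Rightarrow> ('a, 'b) ring_scheme \<Rightarrow> bool"
  where "left_ideal I R \<longleftrightarrow>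
    additive_subgroup I R \<and> (\<forall>a \<in> I. \<forall>x \<in> carrier R. x \<otimes>\<^bsub>R\<^esub> a \<in> I)"

definition gen_left_ideal :: "('a, 'b) ring_scheme \<Rightarrow> 'a set \<Rightarrow> 'a set"
  where "gen_left_ideal R S = \<Inter> {I. left_ideal I R \<and> S \<subseteq> I}"

text \<open>The factors are multiplied in the order of the columns:
  \<open>a\<^bsub>\<sigma>(1),1\<^esub> a\<^bsub>\<sigma>(2),2\<^esub> \<dots> a\<^bsub>\<sigma>(k),k\<^esub>\<close>.\<close>

definition cdet :: "('a, 'b) ring_scheme \<Rightarrow> nat \<Rightarrow> (nat \<Rightarrow> nat \<Rightarrow> 'a) \<Rightarrow> 'a"
  where "cdet R k A =
    (\<Oplus>\<^bsub>R\<^esub>\<sigma> \<in> {\<sigma>. \<sigma> permutes {1..k}}.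
       [(sign \<sigma> :: int)] \<cdot>\<^bsub>R\<^esub> foldr (\<otimes>\<^bsub>R\<^esub>) (map (\<lambda>b. A (\<sigma> b) b) [1..<k + 1]) \<one>\<^bsub>R\<^esub>)"

section \<open>The elements \<open>H\<^sub>k(n)\<close> and the Olshanski decomposition\<close>

text \<open>The summation range consists of the tuples \<open>1 \<le> i\<^sub>1 < \<dots> < i\<^sub>k \<le> n\<close>, as lists; the
  component \<open>i\<^sub>a\<close> is \<open>is ! (a - 1)\<close>. The subtraction \<open>k - a\<close> never truncates since \<open>a \<le> k\<close>.\<close>

definition H_gl :: "nat \<Rightarrow> nat \<Rightarrow> free_alg set"
  where "H_gl k n =
    (\<Oplus>\<^bsub>Ugl n\<^esub>is \<in> {is. length is = k \<and> sorted_wrt (<) is \<and> set is \<subseteq> {1..n}}.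
       cdet (Ugl n) k
         (\<lambda>a b. e_gl n (is ! (a - 1)) (is ! (b - 1))
            \<oplus>\<^bsub>Ugl n\<^esub> (if a = b then [(k - a)] \<cdot>\<^bsub>Ugl n\<^esub> \<one>\<^bsub>Ugl n\<^esub> else \<zero>\<^bsub>Ugl n\<^esub>)))"

definition zeta_gl :: "nat \<Rightarrow> free_alg set set"
  where "zeta_gl n = ring_centralizer (Ugl n) (carrier (Ugl n))"

definition Ugl_zero :: "nat \<Rightarrow> free_alg set set"
  where "Ugl_zero m = ring_centralizer (Ugl m) {e_gl m m m}"

definition I_left :: "nat \<Rightarrow> free_alg set set"
  where "I_left m = gen_left_ideal (Ugl m) {e_gl m i m | i. i \<in> {1..m}}"

definition I_zero :: "nat \<Rightarrow> free_alg set set"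
  where "I_zero m = I_left m \<inter> Ugl_zero m"

definition olshanski_decomposition ::
    "nat \<Rightarrow> free_alg set \<Rightarrow> free_alg set \<Rightarrow> free_alg set \<Rightarrow> bool"
  where "olshanski_decomposition n \<rho> \<rho>' \<rho>0 \<longleftrightarrow>
    \<rho> \<in> zeta_gl (n + 1) \<and> \<rho>' \<in> zeta_gl n \<and> \<rho>0 \<in> I_zero (n + 1) \<and>
    \<rho> = Ugl_incl n \<rho>' \<oplus>\<^bsub>Ugl (n + 1)\<^esub> \<rho>0"

section \<open>Well-definedness\<close>

lemma keys_subset_carrier:
  assumes "Poly_Mapping.keys (h :: free_alg) \<subseteq> Poly_Mapping.keys f \<union> Poly_Mapping.keys g"
    "f \<in> carrier (tensor_gl n)" "g \<in> carrier (tensor_gl n)"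
  shows "h \<in> carrier (tensor_gl n)"
  using assms unfolding tensor_gl_def by auto

lemma tensor_gl_mult_closed:
  assumes "f \<in> carrier (tensor_gl n)" "g \<in> carrier (tensor_gl n)"
  shows "f * g \<in> carrier (tensor_gl n)"
  unfolding tensor_gl_def
proof (simp, intro ballI)
  fix w assume "w \<in> Poly_Mapping.keys (f * g)"
  then obtain u v where "w = u + v" "u \<in> Poly_Mapping.keys f" "v \<in> Poly_Mapping.keys g"
    using Poly_Mapping.keys_mult[of f g] by blast
  then show "set (letters w) \<subseteq> {Suc 0..n} \<times> {Suc 0..n}"
    using assms by (auto simp: tensor_gl_def plus_word_def; force)
qed

lemma tensor_gl_uminus_closed:
  "f \<in> carrier (tensor_gl n) \<Longrightarrow> - f \<in> carrier (tensor_gl n)"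
  by (rule keys_subset_carrier[of _ f f]) simp_all

lemma tensor_gl_ops:
  "x \<otimes>\<^bsub>tensor_gl n\<^esub> y = x * y" "x \<oplus>\<^bsub>tensor_gl n\<^esub> y = x + y"
  "\<one>\<^bsub>tensor_gl n\<^esub> = 1" "\<zero>\<^bsub>tensor_gl n\<^esub> = 0"
  by (simp_all add: tensor_gl_def)

lemma tensor_gl_zero_closed: "0 \<in> carrier (tensor_gl n)"
  by (simp add: tensor_gl_def)

lemma tensor_gl_one_closed: "1 \<in> carrier (tensor_gl n)"
  by (simp add: tensor_gl_def zero_word_def)

lemma tensor_gl_add_closed:
  "f \<in> carrier (tensor_gl n) \<Longrightarrow> g \<in> carrier (tensor_gl n) \<Longrightarrow> f + g \<in> carrier (tensor_gl n)"
  using keys_subset_carrier[OF Poly_Mapping.keys_add] .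

lemma ring_tensor_gl: "ring (tensor_gl n)"
proof (rule ringI)
  show "abelian_group (tensor_gl n)"
  proof (rule abelian_groupI; unfold tensor_gl_ops)
    fix x assume "x \<in> carrier (tensor_gl n)"
    then show "\<exists>y \<in> carrier (tensor_gl n). y + x = 0"
      using tensor_gl_uminus_closed by (intro bexI[of _ "- x"]) simp_all
  qed (simp_all add: tensor_gl_add_closed tensor_gl_zero_closed add.assoc add.commute)
  show "monoid (tensor_gl n)"
    by (rule monoidI; unfold tensor_gl_ops)
      (simp_all add: tensor_gl_mult_closed tensor_gl_one_closed mult.assoc)
qed (simp_all add: tensor_gl_ops distrib_left distrib_right)

lemma free_gen_closed:
  "i \<in> {1..n} \<Longrightarrow> j \<in> {1..n} \<Longrightarrow> free_gen i j \<in> carrier (tensor_gl n)"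
  by (simp add: tensor_gl_def free_gen_def)

lemma tensor_gl_minus_closed:
  "f \<in> carrier (tensor_gl n) \<Longrightarrow> g \<in> carrier (tensor_gl n) \<Longrightarrow> f - g \<in> carrier (tensor_gl n)"
  using keys_subset_carrier[OF Poly_Mapping.keys_diff] .

lemma gl_relations_closed: "gl_relations n \<subseteq> carrier (tensor_gl n)"
proof -
  have "(0 :: free_alg) \<in> carrier (tensor_gl n)" by (simp add: tensor_gl_def)
  then show ?thesis
    unfolding gl_relations_def
    by (auto intro!: tensor_gl_add_closed tensor_gl_minus_closed tensor_gl_mult_closed free_gen_closed)
qed

lemma ideal_gl_ideal: "ideal (gl_ideal n) (tensor_gl n)"
  unfolding gl_ideal_def
  by (rule ring.genideal_ideal[OF ring_tensor_gl gl_relations_closed])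

lemma ring_Ugl: "ring (Ugl n)"
  unfolding Ugl_def by (rule ideal.quotient_is_ring[OF ideal_gl_ideal])

lemma tensor_gl_mono: "carrier (tensor_gl n) \<subseteq> carrier (tensor_gl (n + 1))"
  by (fastforce simp: tensor_gl_def)

lemma gl_ideal_zero: "0 \<in> gl_ideal n"
  using additive_subgroup.zero_closed[OF ideal.axioms(1)[OF ideal_gl_ideal]]
  by (simp add: tensor_gl_ops)

lemma gl_ideal_add: "a \<in> gl_ideal n \<Longrightarrow> b \<in> gl_ideal n \<Longrightarrow> a + b \<in> gl_ideal n"
  using additive_subgroup.a_closed[OF ideal.axioms(1)[OF ideal_gl_ideal]]
  by (metis tensor_gl_ops(2))

lemma tensor_gl_uminus:
  assumes "x \<in> carrier (tensor_gl n)"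
  shows "\<ominus>\<^bsub>tensor_gl n\<^esub> x = - x"
proof -
  interpret R: ring "tensor_gl n" by (rule ring_tensor_gl)
  show ?thesis
    using assms by (intro R.minus_equality) (simp_all add: tensor_gl_ops tensor_gl_uminus_closed)
qed

lemma gl_ideal_uminus:
  assumes "a \<in> gl_ideal n"
  shows "- a \<in> gl_ideal n"
proof -
  have "a \<in> carrier (tensor_gl n)"
    using additive_subgroup.a_Hcarr[OF ideal.axioms(1)[OF ideal_gl_ideal] assms] .
  then show ?thesis
    using additive_subgroup.a_inv_closed[OF ideal.axioms(1)[OF ideal_gl_ideal] assms]
    by (simp add: tensor_gl_uminus)
qed

lemma gl_ideal_mono: "gl_ideal n \<subseteq> gl_ideal (n + 1)"
proof -
  interpret R: ring "tensor_gl n" by (rule ring_tensor_gl)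
  let ?K = "gl_ideal (n + 1) \<inter> carrier (tensor_gl n)"
  have "ideal ?K (tensor_gl n)"
  proof (rule idealI[OF ring_tensor_gl])
    show "subgroup ?K (add_monoid (tensor_gl n))"
    proof (rule R.add.subgroupI)
      show "?K \<noteq> {}"
        using gl_ideal_zero tensor_gl_zero_closed by blast
    next
      fix a assume "a \<in> ?K"
      then show "\<ominus>\<^bsub>tensor_gl n\<^esub> a \<in> ?K"
        by (simp add: tensor_gl_uminus tensor_gl_uminus_closed gl_ideal_uminus)
    next
      fix a b assume "a \<in> ?K" "b \<in> ?K"
      then show "a \<oplus>\<^bsub>tensor_gl n\<^esub> b \<in> ?K"
        by (simp add: tensor_gl_ops gl_ideal_add tensor_gl_add_closed)
    qed simp
  next
    fix a x assume ax: "a \<in> ?K" "x \<in> carrier (tensor_gl n)"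
    then have x: "x \<in> carrier (tensor_gl (n + 1))" using tensor_gl_mono by blast
    show "x \<otimes>\<^bsub>tensor_gl n\<^esub> a \<in> ?K" "a \<otimes>\<^bsub>tensor_gl n\<^esub> x \<in> ?K"
      using ax ideal.I_l_closed[OF ideal_gl_ideal _ x, of a]
        ideal.I_r_closed[OF ideal_gl_ideal _ x, of a]
      by (simp_all add: tensor_gl_ops tensor_gl_mult_closed)
  qed
  moreover have "gl_relations n \<subseteq> gl_relations (n + 1)"
  proof
    fix r assume "r \<in> gl_relations n"
    then obtain i j k l where "i \<in> {1..n}" "j \<in> {1..n}" "k \<in> {1..n}" "l \<in> {1..n}"
      and r: "r = free_gen i j * free_gen k l - free_gen k l * free_gen i j
       - ((if j = k then free_gen i l else 0) - (if l = i then free_gen k j else 0))"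
      unfolding gl_relations_def by blast
    then have "i \<in> {1..n+1}" "j \<in> {1..n+1}" "k \<in> {1..n+1}" "l \<in> {1..n+1}" by auto
    with r show "r \<in> gl_relations (n + 1)"
      unfolding gl_relations_def by blast
  qed
  then have "gl_relations n \<subseteq> ?K"
    using gl_relations_closed[of n]
      ring.genideal_self[OF ring_tensor_gl gl_relations_closed, of "n + 1"]
    unfolding gl_ideal_def by blast
  ultimately show ?thesis
    unfolding gl_ideal_def[of n] using R.genideal_minimal by blast
qed

lemma Ugl_incl_coset:
  assumes "x \<in> carrier (tensor_gl n)"
  shows "Ugl_incl n (gl_ideal n +>\<^bsub>tensor_gl n\<^esub> x) = gl_ideal (n + 1) +>\<^bsub>tensor_gl (n + 1)\<^esub> x"
proof -
  have J_add: "a + b \<in> gl_ideal (n + 1)"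
    if "a \<in> gl_ideal (n + 1)" "b \<in> gl_ideal n" for a b
    using that gl_ideal_add gl_ideal_mono by blast
  show ?thesis
    unfolding Ugl_incl_def set_add_def' a_r_coset_def' tensor_gl_ops
  proof (intro equalityI subsetI)
    fix z assume "z \<in> (\<Union>a \<in> gl_ideal (n + 1). \<Union>c \<in> (\<Union>b \<in> gl_ideal n. {b + x}). {a + c})"
    then obtain a b where ab: "a \<in> gl_ideal (n + 1)" "b \<in> gl_ideal n" "z = (a + b) + x"
      by (auto simp: add.assoc)
    with J_add[OF ab(1,2)] show "z \<in> (\<Union>a \<in> gl_ideal (n + 1). {a + x})" by blast
  next
    fix z assume "z \<in> (\<Union>a \<in> gl_ideal (n + 1). {a + x})"
    then obtain a where a: "a \<in> gl_ideal (n + 1)" "z = a + (0 + x)" by auto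
    with gl_ideal_zero[of n]
    show "z \<in> (\<Union>a \<in> gl_ideal (n + 1). \<Union>c \<in> (\<Union>b \<in> gl_ideal n. {b + x}). {a + c})" by blast
  qed
qed

lemma Ugl_cases:
  assumes "X \<in> carrier (Ugl n)"
  obtains x where "x \<in> carrier (tensor_gl n)" "X = gl_ideal n +>\<^bsub>tensor_gl n\<^esub> x"
  using assms unfolding Ugl_def FactRing_def A_RCOSETS_def' by auto

lemma Ugl_class_hom: "(+>\<^bsub>tensor_gl n\<^esub>) (gl_ideal n) \<in> ring_hom (tensor_gl n) (Ugl n)"
  unfolding Ugl_def by (rule ideal.rcos_ring_hom[OF ideal_gl_ideal])

lemma Ugl_incl_hom: "Ugl_incl n \<in> ring_hom (Ugl n) (Ugl (n + 1))"
proof -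
  note h = Ugl_class_hom[of n] Ugl_class_hom[of "n + 1"]
  note add = ring_hom_add[OF h(1), unfolded tensor_gl_ops] ring_hom_add[OF h(2), unfolded tensor_gl_ops]
  note mult = ring_hom_mult[OF h(1), unfolded tensor_gl_ops] ring_hom_mult[OF h(2), unfolded tensor_gl_ops]
  note one = ring_hom_one[OF h(1), unfolded tensor_gl_ops] ring_hom_one[OF h(2), unfolded tensor_gl_ops]
  have mono: "x \<in> carrier (tensor_gl n) \<Longrightarrow> x \<in> carrier (tensor_gl (n + 1))" for x
    using tensor_gl_mono by blast
  show ?thesis
  proof (rule ring_hom_memI)
    fix X assume "X \<in> carrier (Ugl n)"
    then obtain x where x: "x \<in> carrier (tensor_gl n)" "X = gl_ideal n +>\<^bsub>tensor_gl n\<^esub> x"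
      by (rule Ugl_cases)
    show "Ugl_incl n X \<in> carrier (Ugl (n + 1))"
      unfolding x(2) Ugl_incl_coset[OF x(1)] by (rule ring_hom_closed[OF h(2) mono[OF x(1)]])
    fix Y assume "Y \<in> carrier (Ugl n)"
    then obtain y where y: "y \<in> carrier (tensor_gl n)" "Y = gl_ideal n +>\<^bsub>tensor_gl n\<^esub> y"
      by (rule Ugl_cases)
    show "Ugl_incl n (X \<otimes>\<^bsub>Ugl n\<^esub> Y) = Ugl_incl n X \<otimes>\<^bsub>Ugl (n + 1)\<^esub> Ugl_incl n Y"
      unfolding x(2) y(2) mult(1)[OF x(1) y(1), symmetric] Ugl_incl_coset[OF x(1)]
        Ugl_incl_coset[OF y(1)] Ugl_incl_coset[OF tensor_gl_mult_closed[OF x(1) y(1)]]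
      by (rule mult(2)[OF mono[OF x(1)] mono[OF y(1)]])
    show "Ugl_incl n (X \<oplus>\<^bsub>Ugl n\<^esub> Y) = Ugl_incl n X \<oplus>\<^bsub>Ugl (n + 1)\<^esub> Ugl_incl n Y"
      unfolding x(2) y(2) add(1)[OF x(1) y(1), symmetric] Ugl_incl_coset[OF x(1)]
        Ugl_incl_coset[OF y(1)] Ugl_incl_coset[OF tensor_gl_add_closed[OF x(1) y(1)]]
      by (rule add(2)[OF mono[OF x(1)] mono[OF y(1)]])
  next
    show "Ugl_incl n \<one>\<^bsub>Ugl n\<^esub> = \<one>\<^bsub>Ugl (n + 1)\<^esub>"
      using Ugl_incl_coset[OF tensor_gl_one_closed, of n] unfolding one .
  qed
qed

lemma Ugl_incl_e_gl:
  assumes "i \<in> {1..n}" "j \<in> {1..n}"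
  shows "Ugl_incl n (e_gl n i j) = e_gl (n + 1) i j"
  unfolding e_gl_def by (rule Ugl_incl_coset[OF free_gen_closed[OF assms]])

end

theory Submission
  imports Defs
begin

text \<open>For functions \<open>r, s\<close> from \<open>{1..k}\<close> to \<open>{1..n}\<close> let \<open>D(r; s)\<close> be the column determinant of the
  matrix \<open>e\<^bsub>r(a),s(b)\<^esub> + \<delta>\<^bsub>r(a),s(b)\<^esub> (k - b)\<close>. It is alternating in \<open>r\<close> by construction, and the shifts
  are chosen such that it is also alternating in \<open>s\<close>. Hence the sum of \<open>D(r; r)\<close> over all
  functions \<open>r\<close> equals \<open>k! H\<^sub>k(n)\<close>. The derivation \<open>[e\<^bsub>p,q\<^esub>, -]\<close> treats the entries of the shifted matrix
  like matrix units: it replaces indices \<open>q\<close> of \<open>r\<close> by \<open>p\<close> and, with the opposite sign, indices \<open>p\<close>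
  of \<open>s\<close> by \<open>q\<close>. Over the sum of all \<open>D(r; r)\<close> these contributions cancel, so \<open>H\<^sub>k(n)\<close> is central.

  The summands of \<open>H\<^sub>k(n+1)\<close> that do not occur in \<open>H\<^sub>k(n)\<close> belong to index sets containing
  \<open>n + 1\<close>; there the last column has shift \<open>0\<close>, so every term ends in some \<open>e\<^bsub>i,n+1\<^esub>\<close>.

  The calculations take place in the free algebra, modulo the ideal of relations.\<close>

section \<open>Ordered products\<close>

text \<open>The ring need not be commutative, so a list fixes the order of the factors; it is the
  column order of \<open>cdet\<close>.\<close>

definition ordered_prod :: "nat \<Rightarrow> (nat \<Rightarrow> 'a::ring_1) \<Rightarrow> 'a"
  where "ordered_prod k f = prod_list (map f [1..<k + 1])"

lemma ordered_prod_0 [simp]: "ordered_prod 0 f = 1"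
  by (simp add: ordered_prod_def)

lemma ordered_prod_Suc [simp]: "ordered_prod (Suc k) f = ordered_prod k f * f (Suc k)"
  by (simp add: ordered_prod_def)

lemma ordered_prod_cong:
  assumes "\<And>b. b \<in> {1..k} \<Longrightarrow> f b = g b"
  shows "ordered_prod k f = ordered_prod k g"
  using assms by (induction k) auto

lemma ordered_prod_upd_outside [simp]:
  "b \<notin> {1..k} \<Longrightarrow> ordered_prod k (f(b := x)) = ordered_prod k f"
  by (rule ordered_prod_cong) auto

lemma ordered_prod_upd_diff:
  "b \<in> {1..k} \<Longrightarrow>
    ordered_prod k (f(b := x - y)) = ordered_prod k (f(b := x)) - ordered_prod k (f(b := y))"
proof (induction k)
  case (Suc k)
  show ?case
  proof (cases "b = Suc k")
    case True
    then show ?thesis by (simp add: right_diff_distrib del: fun_upd_apply) (simp add: right_diff_distrib)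
  next
    case False
    with Suc show ?thesis by (simp add: left_diff_distrib)
  qed
qed simp

lemma ordered_prod_upd_zero: "b \<in> {1..k} \<Longrightarrow> ordered_prod k (f(b := 0)) = 0"
  using ordered_prod_upd_diff[of b k f 0 0] by simp

text \<open>Leibniz rule for the inner derivation by \<open>x\<close>: each update differentiates
  one factor and leaves the others in place.\<close>

lemma ordered_prod_commutator:
  "x * ordered_prod k f - ordered_prod k f * x
    = (\<Sum>b = 1..k. ordered_prod k (f(b := x * f b - f b * x)))"
proof (induction k)
  case (Suc k)
  have "x * ordered_prod (Suc k) f - ordered_prod (Suc k) f * x
    = (x * ordered_prod k f - ordered_prod k f * x) * f (Suc k)
      + ordered_prod k f * (x * f (Suc k) - f (Suc k) * x)"
    by (simp add: algebra_simps)
  also have "\<dots> = (\<Sum>b = 1..k. ordered_prod (Suc k) (f(b := x * f b - f b * x)))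
      + ordered_prod (Suc k) (f(Suc k := x * f (Suc k) - f (Suc k) * x))"
    unfolding Suc.IH sum_distrib_right
    by (intro arg_cong2[of _ _ _ _ "(+)"] sum.cong arg_cong2[of _ _ _ _ "(*)"])
      (auto simp del: fun_upd_apply, auto)
  finally show ?case by (simp del: fun_upd_apply ordered_prod_Suc)
qed simp

text \<open>Isolates two neighbouring factors, so that a relation between them can be multiplied by
  what stands on either side.\<close>

lemma ordered_prod_split_pair:
  assumes "1 \<le> b" "b + 1 \<le> k"
  shows "ordered_prod k f
    = ordered_prod (b - 1) f * (f b * f (b + 1)) * prod_list (map f [b + 2..<k + 1])"
proof -
  have "[1..<k + 1] = [1..<b] @ [b, b + 1] @ [b + 2..<k + 1]"
    using assms upt_add_eq_append[of 1 b "k + 1 - b"] upt_conv_Cons[of b "k + 1"]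
      upt_conv_Cons[of "b + 1" "k + 1"] by simp
  then show ?thesis using assms by (simp add: ordered_prod_def mult.assoc)
qed

section \<open>Capelli elements modulo the relations of \<open>gl(n)\<close>\<close>

text \<open>\<open>J\<close> absorbs multiplication by elements of \<open>A\<close> only, because in
  the application the type also contains generators with indices beyond \<open>n\<close>. Membership
  in \<open>J\<close>, instead of equality in a quotient, keeps the arithmetic of the type class
  available. \<open>J_cancel\<close> permits division by 2 and by \<open>k!\<close>.\<close>

locale gl_mod =
  fixes A J :: "'a::ring_1 set" and e :: "nat \<Rightarrow> nat \<Rightarrow> 'a" and n :: nat
  assumes A_one: "1 \<in> A"
    and A_diff: "x \<in> A \<Longrightarrow> y \<in> A \<Longrightarrow> x - y \<in> A"
    and A_mult: "x \<in> A \<Longrightarrow> y \<in> A \<Longrightarrow> x * y \<in> A"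
    and J_zero: "0 \<in> J"
    and J_diff: "x \<in> J \<Longrightarrow> y \<in> J \<Longrightarrow> x - y \<in> J"
    and J_mult_left: "a \<in> A \<Longrightarrow> x \<in> J \<Longrightarrow> a * x \<in> J"
    and J_mult_right: "x \<in> J \<Longrightarrow> a \<in> A \<Longrightarrow> x * a \<in> J"
    and J_cancel: "0 < m \<Longrightarrow> of_nat m * x \<in> J \<Longrightarrow> x \<in> J"
    and e_in: "i \<in> {1..n} \<Longrightarrow> j \<in> {1..n} \<Longrightarrow> e i j \<in> A"
    and e_rel: "\<lbrakk>i \<in> {1..n}; j \<in> {1..n}; p \<in> {1..n}; q \<in> {1..n}\<rbrakk> \<Longrightarrow>
      e i j * e p q - e p q * e i j
        - ((if j = p then e i q else 0) - (if q = i then e p j else 0)) \<in> J"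
begin

section \<open>Closure properties of the subring and the ideal\<close>

lemma A_zero: "0 \<in> A" using A_diff[OF A_one A_one] by simp
lemma A_uminus: "x \<in> A \<Longrightarrow> - x \<in> A" using A_diff[OF A_zero] by simp
lemma A_add: "x \<in> A \<Longrightarrow> y \<in> A \<Longrightarrow> x + y \<in> A" using A_diff[of x "- y"] A_uminus by simp
lemma A_sum: "(\<And>x. x \<in> X \<Longrightarrow> f x \<in> A) \<Longrightarrow> sum f X \<in> A"
  by (induction X rule: infinite_finite_induct) (auto simp: A_zero A_add)
lemma A_of_nat: "of_nat m \<in> A" by (induction m) (auto simp: A_zero A_one A_add)
lemma A_of_int: "of_int m \<in> A" by (cases m rule: int_diff_cases) (auto simp: A_diff A_of_nat)
lemma A_prod_list: "(\<And>x. x \<in> set xs \<Longrightarrow> x \<in> A) \<Longrightarrow> prod_list xs \<in> A"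
  by (induction xs) (auto simp: A_one A_mult)
lemma A_ordered_prod: "(\<And>b. b \<in> {1..k} \<Longrightarrow> f b \<in> A) \<Longrightarrow> ordered_prod k f \<in> A"
  unfolding ordered_prod_def by (rule A_prod_list) auto

lemma J_uminus: "x \<in> J \<Longrightarrow> - x \<in> J" using J_diff[OF J_zero] by simp
lemma J_add: "x \<in> J \<Longrightarrow> y \<in> J \<Longrightarrow> x + y \<in> J" using J_diff[of x "- y"] J_uminus by simp
lemma J_sum: "(\<And>x. x \<in> X \<Longrightarrow> f x \<in> J) \<Longrightarrow> sum f X \<in> J"
  by (induction X rule: infinite_finite_induct) (auto simp: J_zero J_add)
lemma J_ordered_prod:
  "\<lbrakk>\<And>b. b \<in> {1..k} \<Longrightarrow> f b \<in> A; c \<in> {1..k}; x \<in> J\<rbrakk> \<Longrightarrow> ordered_prod k (f(c := x)) \<in> J"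
proof (induction k)
  case (Suc k)
  show ?case
  proof (cases "c = Suc k")
    case True
    with Suc show ?thesis by (auto intro!: J_mult_left A_ordered_prod)
  next
    case False
    with Suc show ?thesis by (auto intro!: J_mult_right)
  qed
qed simp

section \<open>Shifted column determinants and their rows\<close>

definition shifted :: "nat \<Rightarrow> nat \<Rightarrow> nat \<Rightarrow> 'a"
  where "shifted c i j = e i j + (if i = j then of_nat c else 0)"

text \<open>The amount \<open>k - b\<close> belongs to the column position, but whether it is added
  depends on equality of the labels \<open>r (\<sigma> b)\<close> and \<open>s b\<close>. This makes
  sense for arbitrary label functions, with repetitions allowed.\<close>

definition minor :: "nat \<Rightarrow> (nat \<Rightarrow> nat) \<Rightarrow> (nat \<Rightarrow> nat) \<Rightarrow> 'a"
  where "minor k r s = (\<Sum>\<sigma> | \<sigma> permutes {1..k}.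
    of_int (sign \<sigma>) * ordered_prod k (\<lambda>b. shifted (k - b) (r (\<sigma> b)) (s b)))"

lemma shifted_in: "i \<in> {1..n} \<Longrightarrow> j \<in> {1..n} \<Longrightarrow> shifted c i j \<in> A"
  by (auto simp: shifted_def intro!: A_add e_in A_of_nat A_zero)

lemma minor_in:
  assumes "r \<in> {1..k} \<rightarrow> {1..n}" "s \<in> {1..k} \<rightarrow> {1..n}"
  shows "minor k r s \<in> A"
  unfolding minor_def
  using assms
  by (intro A_sum A_mult A_of_int A_ordered_prod shifted_in)
    (auto simp: Pi_iff permutes_in_image simp del: atLeastAtMost_iff)

lemma minor_cong:
  assumes "\<And>b. b \<in> {1..k} \<Longrightarrow> r b = r' b" "\<And>b. b \<in> {1..k} \<Longrightarrow> s b = s' b"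
  shows "minor k r s = minor k r' s'"
  unfolding minor_def
  using assms
  by (intro sum.cong arg_cong2[of _ _ _ _ "(*)"] ordered_prod_cong)
    (auto simp: permutes_in_image simp del: atLeastAtMost_iff)

text \<open>Replacing \<sigma> by \<open>\<pi> \<circ> \<sigma>\<close> in the sum only changes
  signs, since neither the amounts \<open>k - b\<close> nor the column labels depend on \<sigma>.
  Hence this is an identity in the ring, not merely modulo \<open>J\<close>.\<close>

lemma minor_permute_rows:
  assumes "\<pi> permutes {1..k}"
  shows "minor k (r \<circ> \<pi>) s = of_int (sign \<pi>) * minor k r s"
proof -
  have *: "of_int (sign \<sigma>) = (of_int (sign \<pi>) * of_int (sign (\<pi> \<circ> \<sigma>)) :: 'a)"
    if "\<sigma> permutes {1..k}" for \<sigma>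
  proof -
    have "sign (\<pi> \<circ> \<sigma>) = sign \<pi> * sign \<sigma>"
      using sign_compose assms that permutation_permutes finite_atLeastAtMost by blast
    then have "sign \<sigma> = sign \<pi> * sign (\<pi> \<circ> \<sigma>)" 
      by (simp flip: mult.assoc)
    then show ?thesis by (metis of_int_mult)
  qed
  show ?thesis
    unfolding minor_def
    by (subst (2) setum_permutations_compose_left[OF assms])
      (auto simp: sum_distrib_left * mult.assoc intro!: sum.cong)
qed

section \<open>Alternation in the columns modulo the relations\<close>

lemma swap_pair:
  assumes "i \<in> {1..n}" "i' \<in> {1..n}" "j \<in> {1..n}" "j' \<in> {1..n}"
  shows "shifted (Suc c) i j * shifted c i' j' - shifted (Suc c) i' j * shifted c i j'
    + (shifted (Suc c) i j' * shifted c i' j - shifted (Suc c) i' j' * shifted c i j) \<in> J"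
    (is "?M \<in> J")
proof -
  let ?r = "\<lambda>i j p q. e i j * e p q - e p q * e i j
        - ((if j = p then e i q else 0) - (if q = i then e p j else 0))"
  \<comment> \<open>The quadratic terms of \<open>?M\<close> are two commutators of matrix units.
    Since the left shift exceeds the right one by exactly 1, the linear terms are the negatives of
    the corresponding brackets, and the constants cancel.\<close>
  have "?M = ?r i j i' j' + ?r i j' i' j"
    using mult_of_nat_commute[of c "e _ _"] by (auto simp: shifted_def algebra_simps)
  then show ?thesis using assms by (simp only: J_add e_rel)
qed

lemma double_cancel: "x + x \<in> J \<Longrightarrow> x \<in> J"
  using J_cancel[of 2 x] by (simp add: mult_2)

lemma minor_swap_columns:
  assumes b: "1 \<le> b" "b + 1 \<le> k" and r: "r \<in> {1..k} \<rightarrow> {1..n}" and s: "s \<in> {1..k} \<rightarrow> {1..n}"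
  shows "minor k r s + minor k r (s \<circ> transpose b (b + 1)) \<in> J"
proof -
  let ?\<tau> = "transpose b (b + 1)" and ?P = "{\<sigma>. \<sigma> permutes {1..k}}"
  define W where "W \<sigma> t = ordered_prod k (\<lambda>b. shifted (k - b) (r (\<sigma> b)) (t b))" for \<sigma> t
  have \<tau>: "?\<tau> permutes {1..k}" using b by (intro permutes_swap_id) auto
  have sgn: "of_int (sign (\<sigma> \<circ> ?\<tau>)) = (- of_int (sign \<sigma>) :: 'a)" if "\<sigma> \<in> ?P" for \<sigma>
  proof -
    have "sign (\<sigma> \<circ> ?\<tau>) = sign \<sigma> * sign ?\<tau>"
      using that \<tau> by (intro sign_compose) (auto intro: permutes_imp_permutation[OF finite_atLeastAtMost])
    then show ?thesis by (simp add: sign_swap_id)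
  qed
  \<comment> \<open>Composition with the transposition pairs the permutations. Doubling the
    determinant counts every pair twice, which avoids choosing representatives;
    \<open>double_cancel\<close> removes the factor 2 at the end.\<close>
  have half: "minor k r t + minor k r t = (\<Sum>\<sigma>\<in>?P. of_int (sign \<sigma>) * (W \<sigma> t - W (\<sigma> \<circ> ?\<tau>) t))" for t
  proof -
    have "minor k r t = (\<Sum>\<sigma>\<in>?P. of_int (sign \<sigma>) * W \<sigma> t)"
      by (simp add: minor_def W_def)
    moreover have "\<dots> = (\<Sum>\<sigma>\<in>?P. of_int (sign (\<sigma> \<circ> ?\<tau>)) * W (\<sigma> \<circ> ?\<tau>) t)"
      by (rule sum_permutations_compose_right[OF \<tau>])
    moreover have "\<dots> = (\<Sum>\<sigma>\<in>?P. - (of_int (sign \<sigma>) * W (\<sigma> \<circ> ?\<tau>) t))"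
      using sgn by (intro sum.cong) auto
    ultimately show ?thesis
      by (simp add: algebra_simps sum.distrib sum_subtractf sum_negf)
  qed
  have pair: "W \<sigma> s - W (\<sigma> \<circ> ?\<tau>) s + (W \<sigma> (s \<circ> ?\<tau>) - W (\<sigma> \<circ> ?\<tau>) (s \<circ> ?\<tau>)) \<in> J"
    if "\<sigma> \<in> ?P" for \<sigma>
  proof -
    from that have \<sigma>: "\<sigma> permutes {1..k}" by simp
    let ?f = "\<lambda>a. shifted (k - a) (r (\<sigma> a)) (s a)"
    let ?L = "ordered_prod (b - 1) ?f" and ?R = "prod_list (map ?f [b + 2..<k + 1])"
    have in_n: "r (\<sigma> a) \<in> {1..n}" "s a \<in> {1..n}" if "a \<in> {1..k}" for a
      using r s that permutes_in_image[OF \<sigma>] by (auto simp: Pi_iff simp del: atLeastAtMost_iff)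
    have c: "k - b = Suc (k - (b + 1))" using b by simp
    \<comment> \<open>The transposition moves only \<open>b\<close> and \<open>b + 1\<close>, so all
      four combinations share the outer factors \<open>?L\<close> and \<open>?R\<close>.\<close>
    have form: "W (\<sigma> \<circ> \<mu>) (s \<circ> \<nu>)
      = ?L * (shifted (k - b) (r (\<sigma> (\<mu> b))) (s (\<nu> b))
          * shifted (k - (b + 1)) (r (\<sigma> (\<mu> (b + 1)))) (s (\<nu> (b + 1)))) * ?R"
      if "\<mu> \<in> {id, ?\<tau>}" "\<nu> \<in> {id, ?\<tau>}" for \<mu> \<nu>
      unfolding W_def ordered_prod_split_pair[OF b]
    proof (intro arg_cong2[of _ _ _ _ "(*)"] ordered_prod_cong arg_cong[of _ _ prod_list] map_cong)
    qed (use that in \<open>auto simp: transpose_def\<close>)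
    have "?L * (shifted (Suc (k - (b + 1))) (r (\<sigma> b)) (s b)
          * shifted (k - (b + 1)) (r (\<sigma> (b + 1))) (s (b + 1))
        - shifted (Suc (k - (b + 1))) (r (\<sigma> (b + 1))) (s b)
          * shifted (k - (b + 1)) (r (\<sigma> b)) (s (b + 1))
        + (shifted (Suc (k - (b + 1))) (r (\<sigma> b)) (s (b + 1))
          * shifted (k - (b + 1)) (r (\<sigma> (b + 1))) (s b)
        - shifted (Suc (k - (b + 1))) (r (\<sigma> (b + 1))) (s (b + 1))
          * shifted (k - (b + 1)) (r (\<sigma> b)) (s b))) * ?R \<in> J" (is "?X \<in> J")
    proof (rule J_mult_right[OF J_mult_left[OF _ swap_pair]])
      show "?L \<in> A" using b in_n by (intro A_ordered_prod shifted_in) auto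
      show "?R \<in> A" using b in_n by (intro A_prod_list) (auto intro!: shifted_in)
    qed (use b in_n in auto)
    also have "?X = W \<sigma> s - W (\<sigma> \<circ> ?\<tau>) s + (W \<sigma> (s \<circ> ?\<tau>) - W (\<sigma> \<circ> ?\<tau>) (s \<circ> ?\<tau>))"
      using form[of id id] form[of ?\<tau> id] form[of id ?\<tau>] form[of ?\<tau> ?\<tau>]
      unfolding c by (simp add: algebra_simps)
    finally show ?thesis .
  qed
  let ?x = "minor k r s + minor k r (s \<circ> ?\<tau>)"
  have "?x + ?x = (minor k r s + minor k r s)
      + (minor k r (s \<circ> ?\<tau>) + minor k r (s \<circ> ?\<tau>))"
    by (simp add: algebra_simps)
  also have "\<dots> = (\<Sum>\<sigma>\<in>?P. of_int (sign \<sigma>) *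
      (W \<sigma> s - W (\<sigma> \<circ> ?\<tau>) s + (W \<sigma> (s \<circ> ?\<tau>) - W (\<sigma> \<circ> ?\<tau>) (s \<circ> ?\<tau>))))"
    unfolding half by (simp add: algebra_simps sum.distrib sum_subtractf)
  also have "\<dots> \<in> J"
    using pair by (intro J_sum J_mult_left A_of_int) auto
  finally show ?thesis by (rule double_cancel)
qed

section \<open>Simultaneous permutation of rows and columns\<close>

definition fixes_minors :: "nat \<Rightarrow> (nat \<Rightarrow> nat) \<Rightarrow> bool"
  where "fixes_minors k \<pi> \<longleftrightarrow> \<pi> permutes {1..k} \<and>
    (\<forall>r \<in> {1..k} \<rightarrow> {1..n}. \<forall>s \<in> {1..k} \<rightarrow> {1..n}. minor k (r \<circ> \<pi>) (s \<circ> \<pi>) - minor k r s \<in> J)"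

text \<open>As \<open>fixes_minors\<close> quantifies over all label functions, the condition for
  \<rho> applies to \<open>r \<circ> \<pi>\<close> and \<open>s \<circ> \<pi>\<close>. It therefore
  suffices to treat generators of the symmetric group.\<close>

lemma fixes_minors_comp:
  assumes "fixes_minors k \<pi>" "fixes_minors k \<rho>"
  shows "fixes_minors k (\<pi> \<circ> \<rho>)"
  unfolding fixes_minors_def
proof (intro conjI ballI)
  show "\<pi> \<circ> \<rho> permutes {1..k}"
    using assms permutes_compose by (auto simp: fixes_minors_def)
  fix r s assume rs: "r \<in> {1..k} \<rightarrow> {1..n}" "s \<in> {1..k} \<rightarrow> {1..n}"
  have \<pi>: "\<pi> permutes {1..k}" using assms by (simp add: fixes_minors_def)
  have "r \<circ> \<pi> \<in> {1..k} \<rightarrow> {1..n}" "s \<circ> \<pi> \<in> {1..k} \<rightarrow> {1..n}"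
    using rs permutes_in_image[OF \<pi>] by (auto simp: Pi_iff simp del: atLeastAtMost_iff)
  then have "minor k (r \<circ> \<pi> \<circ> \<rho>) (s \<circ> \<pi> \<circ> \<rho>) - minor k (r \<circ> \<pi>) (s \<circ> \<pi>) \<in> J"
    using assms(2) by (simp add: fixes_minors_def)
  moreover have "minor k (r \<circ> \<pi>) (s \<circ> \<pi>) - minor k r s \<in> J"
    using assms(1) rs by (simp add: fixes_minors_def)
  ultimately show "minor k (r \<circ> (\<pi> \<circ> \<rho>)) (s \<circ> (\<pi> \<circ> \<rho>)) - minor k r s \<in> J"
    using J_add by (fastforce simp: comp_assoc)
qed

lemma fixes_minors_id: "fixes_minors k id"
  by (simp add: fixes_minors_def J_zero permutes_id)

text \<open>The row swap gives the sign -1 exactly, the column swap gives it modulo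
  \<open>J\<close>, and the two signs cancel.\<close>

lemma fixes_minors_adjacent:
  assumes b: "1 \<le> b" "b + 1 \<le> k"
  shows "fixes_minors k (transpose b (b + 1))" (is "fixes_minors k ?\<tau>")
  unfolding fixes_minors_def
proof (intro conjI ballI)
  show \<tau>: "?\<tau> permutes {1..k}" using b by (intro permutes_swap_id) auto
  fix r s assume rs: "r \<in> {1..k} \<rightarrow> {1..n}" "s \<in> {1..k} \<rightarrow> {1..n}"
  have "minor k (r \<circ> ?\<tau>) (s \<circ> ?\<tau>) - minor k r s
    = - (minor k r s + minor k r (s \<circ> ?\<tau>))"
    unfolding minor_permute_rows[OF \<tau>] by (simp add: sign_swap_id)
  then show "minor k (r \<circ> ?\<tau>) (s \<circ> ?\<tau>) - minor k r s \<in> J"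
    using minor_swap_columns[OF b rs] by (simp only: J_uminus)
qed

text \<open>Induction on the distance: conjugation by an adjacent transposition moves the right end
  one step further. Writing the distance as \<open>d + 1\<close> excludes the trivial
  transposition.\<close>

lemma fixes_minors_transpose:
  "1 \<le> a \<Longrightarrow> a + d + 1 \<le> k \<Longrightarrow> fixes_minors k (transpose a (a + d + 1))"
proof (induction d)
  case 0
  then show ?case using fixes_minors_adjacent by simp
next
  case (Suc d)
  have "transpose a (a + Suc d + 1)
    = transpose (a + d + 1) (a + d + 1 + 1) \<circ> transpose a (a + d + 1)
      \<circ> transpose (a + d + 1) (a + d + 1 + 1)"
    by (auto simp: transpose_def fun_eq_iff)
  then show ?case
    using Suc fixes_minors_adjacent[of "a + d + 1" k] by (auto intro!: fixes_minors_comp simp del: o_apply)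
qed

lemma fixes_minors_permutes:
  assumes "\<pi> permutes {1..k}"
  shows "fixes_minors k \<pi>"
  using assms finite_atLeastAtMost
proof (induction rule: permutes_induct)
  case (swap a b p)
  have "fixes_minors k (transpose a b)"
  proof (cases "a < b")
    case True
    then show ?thesis using fixes_minors_transpose[of a "b - a - 1" k] swap by simp
  next
    case False
    then show ?thesis
      using fixes_minors_transpose[of b "a - b - 1" k] swap by (simp add: transpose_commute)
  qed
  then show ?case using swap fixes_minors_comp by blast
qed (rule fixes_minors_id)

text \<open>Transposing two positions with equal row labels fixes \<open>r\<close> but changes the
  sign, so twice the determinant is 0.\<close>

lemma minor_not_inj:
  assumes "\<not> inj_on r {1..k}"
  shows "minor k r s \<in> J"
proof -
  obtain a b where ab: "a \<in> {1..k}" "b \<in> {1..k}" "a \<noteq> b" "r a = r b"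
    using assms by (auto simp: inj_on_def)
  have "r \<circ> transpose a b = r" using ab by (auto simp: transpose_def)
  then have "minor k r s = - minor k r s"
    using minor_permute_rows[OF permutes_swap_id[OF ab(1,2)], of r s] ab by (simp add: sign_swap_id)
  then have "minor k r s + minor k r s = 0" by (metis add.right_inverse)
  then show ?thesis using double_cancel J_zero by metis
qed

section \<open>The derivation by a matrix unit and sums over index functions\<close>

lemma commutator_shifted:
  assumes "p \<in> {1..n}" "q \<in> {1..n}" "i \<in> {1..n}" "j \<in> {1..n}"
  shows "(e p q * shifted c i j - shifted c i j * e p q)
    - ((if i = q then shifted c p j else 0) - (if j = p then shifted c i q else 0)) \<in> J"
    (is "?M \<in> J")
proof -
  \<comment> \<open>Constants are central and drop out of the commutator. Each of the two
    replacement terms contains the shift exactly when \<open>i = q\<close> and \<open>j = p\<close>,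
    and then the shifts cancel.\<close>
  have "?M = e p q * e i j - e i j * e p q
        - ((if q = i then e p j else 0) - (if j = p then e i q else 0))"
    using mult_of_nat_commute[of c "e _ _"] by (auto simp: shifted_def algebra_simps)
  then show ?thesis using assms by (simp only: e_rel)
qed

text \<open>Extensional functions, so that the set is finite and can be summed over.\<close>

definition index_funs :: "nat \<Rightarrow> (nat \<Rightarrow> nat) set"
  where "index_funs k = {1..k} \<rightarrow>\<^sub>E {1..n}"

lemma index_funs_in: "r \<in> index_funs k \<Longrightarrow> a \<in> {1..k} \<Longrightarrow> r a \<in> {1..n}"
  by (auto simp: index_funs_def)

lemma finite_index_funs: "finite (index_funs k)"
  by (simp add: index_funs_def finite_PiE)

lemma index_funs_upd:
  "r \<in> index_funs k \<Longrightarrow> a \<in> {1..k} \<Longrightarrow> x \<in> {1..n} \<Longrightarrow> r(a := x) \<in> index_funs k"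
  unfolding index_funs_def by (simp add: PiE_iff extensional_def)

text \<open>Overwriting the label \<open>q\<close> at \<open>a\<close> by \<open>p\<close> is a
  bijection between the two ranges, with the reverse overwriting as inverse.\<close>

lemma sum_index_funs_shift:
  assumes "p \<in> {1..n}" "q \<in> {1..n}" "a \<in> {1..k}"
  shows "(\<Sum>r \<in> {r \<in> index_funs k. r a = q}. G (r(a := p)) r)
    = (\<Sum>r \<in> {r \<in> index_funs k. r a = p}. G r (r(a := q)))"
  using assms index_funs_upd
  by (intro sum.reindex_bij_witness[of _ "\<lambda>r. r(a := q)" "\<lambda>r. r(a := p)"])
    (auto simp: fun_upd_idem simp del: atLeastAtMost_iff)

text \<open>The two families of terms produced by the derivation [e p q, -] cancel against each other
  after summation over all index functions, even for a single permutation.\<close>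

lemma commutator_sum_ordered_prod:
  assumes pq: "p \<in> {1..n}" "q \<in> {1..n}" and \<sigma>: "\<sigma> permutes {1..k}"
  defines "W \<equiv> \<lambda>r s. ordered_prod k (\<lambda>b. shifted (k - b) (r (\<sigma> b)) (s b))"
  shows "(\<Sum>r \<in> index_funs k. e p q * W r r - W r r * e p q) \<in> J"
proof -
  let ?T = "\<lambda>r b. shifted (k - b) (r (\<sigma> b)) (r b)"
  \<comment> \<open>The commutator with the factor at \<open>b\<close>, as predicted by
    \<open>commutator_shifted\<close>: a row label \<open>q\<close> becomes \<open>p\<close>, and,
    with a minus sign, a column label \<open>p\<close> becomes \<open>q\<close>.\<close>
  let ?z = "\<lambda>r b. (if r (\<sigma> b) = q then shifted (k - b) p (r b) else 0)
    - (if r b = p then shifted (k - b) (r (\<sigma> b)) q else 0)"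
  let ?F = "index_funs k"
  have \<sigma>_in: "\<sigma> b \<in> {1..k} \<longleftrightarrow> b \<in> {1..k}" for b using \<sigma> by (rule permutes_in_image)
  have inj: "\<sigma> b = \<sigma> b' \<longleftrightarrow> b = b'" for b b' using \<sigma> by (metis permutes_inverses(2))
  \<comment> \<open>Inserting the predicted value amounts to changing the row function at
    \<open>\<sigma> b\<close> or the column function at \<open>b\<close>. As \<sigma> is injective,
    the former affects no other factor.\<close>
  have expand: "ordered_prod k ((?T r)(b := ?z r b))
    = (if r (\<sigma> b) = q then W (r(\<sigma> b := p)) r else 0) - (if r b = p then W r (r(b := q)) else 0)"
    if b: "b \<in> {1..k}" for r b
  proof -
    have "ordered_prod k ((?T r)(b := if r (\<sigma> b) = q then shifted (k - b) p (r b) else 0))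
        = (if r (\<sigma> b) = q then W (r(\<sigma> b := p)) r else 0)"
      using b by (auto simp: W_def ordered_prod_upd_zero inj intro!: ordered_prod_cong)
    moreover have "ordered_prod k ((?T r)(b := if r b = p then shifted (k - b) (r (\<sigma> b)) q else 0))
        = (if r b = p then W r (r(b := q)) else 0)"
      using b by (auto simp: W_def ordered_prod_upd_zero intro!: ordered_prod_cong)
    ultimately show ?thesis by (simp only: ordered_prod_upd_diff[OF b])
  qed
  have "(\<Sum>r\<in>?F. \<Sum>b = 1..k. ordered_prod k ((?T r)(b := ?z r b)))
    = (\<Sum>b = 1..k. \<Sum>r\<in>?F. if r (\<sigma> b) = q then W (r(\<sigma> b := p)) r else 0)
      - (\<Sum>b = 1..k. \<Sum>r\<in>?F. if r b = p then W r (r(b := q)) else 0)"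
    by (simp only: sum.swap[of _ "{1..k}" ?F] sum_subtractf[symmetric])
      (intro sum.cong refl expand)
  \<comment> \<open>Summation over all \<open>b\<close> lets the row position
    \<open>\<sigma> b\<close> be renamed to \<open>b\<close>; then
    \<open>sum_index_funs_shift\<close> matches row terms with column terms.\<close>
  also have "(\<Sum>b = 1..k. \<Sum>r\<in>?F. if r (\<sigma> b) = q then W (r(\<sigma> b := p)) r else 0)
    = (\<Sum>b = 1..k. \<Sum>r\<in>?F. if r b = q then W (r(b := p)) r else 0)"
    using sum.permute[OF \<sigma>, of "\<lambda>b. \<Sum>r\<in>?F. if r b = q then W (r(b := p)) r else 0"]
    by (simp add: comp_def)
  also have "\<dots> = (\<Sum>b = 1..k. \<Sum>r\<in>?F. if r b = p then W r (r(b := q)) else 0)"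
    using sum_index_funs_shift[OF pq, of _ k W]
    by (intro sum.cong[OF refl, of "{1..k}"]) (simp add: sum.inter_filter[OF finite_index_funs] del: atLeastAtMost_iff)
  finally have zero: "(\<Sum>r\<in>?F. \<Sum>b = 1..k. ordered_prod k ((?T r)(b := ?z r b))) = 0"
    by (simp only: diff_self)
  \<comment> \<open>Subtracting the vanishing sum turns each inserted factor into the difference
    between the commutator and its predicted value, which lies in \<open>J\<close>.\<close>
  have "(\<Sum>r\<in>?F. e p q * W r r - W r r * e p q)
    = (\<Sum>r\<in>?F. \<Sum>b = 1..k. ordered_prod k ((?T r)(b := e p q * ?T r b - ?T r b * e p q)))
      - (\<Sum>r\<in>?F. \<Sum>b = 1..k. ordered_prod k ((?T r)(b := ?z r b)))"
    unfolding zero W_def ordered_prod_commutator by simp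
  also have "\<dots> = (\<Sum>r\<in>?F. \<Sum>b = 1..k.
      ordered_prod k ((?T r)(b := e p q * ?T r b - ?T r b * e p q - ?z r b)))"
    unfolding sum_subtractf[symmetric] by (intro sum.cong refl ordered_prod_upd_diff[symmetric])
  also have "\<dots> \<in> J"
    using pq index_funs_in \<sigma>_in
    by (intro J_sum J_ordered_prod commutator_shifted shifted_in) (simp_all del: atLeastAtMost_iff)
  finally show ?thesis .
qed

lemma commutator_sum_minor:
  assumes pq: "p \<in> {1..n}" "q \<in> {1..n}"
  shows "e p q * (\<Sum>r \<in> index_funs k. minor k r r) - (\<Sum>r \<in> index_funs k. minor k r r) * e p q \<in> J"
proof -
  let ?P = "{\<sigma>. \<sigma> permutes {1..k}}" and ?F = "index_funs k"
  let ?W = "\<lambda>\<sigma> r. ordered_prod k (\<lambda>b. shifted (k - b) (r (\<sigma> b)) (r b))"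
  have "(\<Sum>r\<in>?F. minor k r r) = (\<Sum>\<sigma>\<in>?P. of_int (sign \<sigma>) * (\<Sum>r\<in>?F. ?W \<sigma> r))"
    unfolding minor_def by (subst sum.swap) (simp add: sum_distrib_left)
  then have "e p q * (\<Sum>r\<in>?F. minor k r r) - (\<Sum>r\<in>?F. minor k r r) * e p q
    = (\<Sum>\<sigma>\<in>?P. e p q * (of_int (sign \<sigma>) * (\<Sum>r\<in>?F. ?W \<sigma> r))
        - of_int (sign \<sigma>) * (\<Sum>r\<in>?F. ?W \<sigma> r) * e p q)"
    by (simp only: sum_distrib_left[of "e p q" _ ?P] sum_distrib_right[of _ ?P "e p q"] sum_subtractf)
  also have "\<dots> = (\<Sum>\<sigma>\<in>?P. of_int (sign \<sigma>) * (\<Sum>r\<in>?F. e p q * ?W \<sigma> r - ?W \<sigma> r * e p q))"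
  proof (rule sum.cong[OF refl])
    fix \<sigma> :: "nat \<Rightarrow> nat"
    have "e p q * (of_int (sign \<sigma>) * S) - of_int (sign \<sigma>) * S * e p q
      = of_int (sign \<sigma>) * (e p q * S - S * e p q)" for S :: 'a
      by (metis mult.assoc mult_of_int_commute right_diff_distrib)
    then show "e p q * (of_int (sign \<sigma>) * (\<Sum>r\<in>?F. ?W \<sigma> r))
        - of_int (sign \<sigma>) * (\<Sum>r\<in>?F. ?W \<sigma> r) * e p q
      = of_int (sign \<sigma>) * (\<Sum>r\<in>?F. e p q * ?W \<sigma> r - ?W \<sigma> r * e p q)"
      by (simp only: sum_distrib_left[of "e p q"] sum_distrib_right[of _ ?F "e p q"] sum_subtractf)
  qed
  also have "\<dots> \<in> J"
    proof (rule J_sum, rule J_mult_left[OF A_of_int])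
  qed (use commutator_sum_ordered_prod[OF pq] in auto)
  finally show ?thesis .
qed

section \<open>From index functions to increasing index lists\<close>

definition index_lists :: "nat \<Rightarrow> nat list set"
  where "index_lists k = {is. length is = k \<and> sorted_wrt (<) is \<and> set is \<subseteq> {1..n}}"

text \<open>In the interpretation below this is a representative of \<open>H_gl k n\<close> in the
  free algebra; see \<open>H_gl_class\<close>.\<close>

definition capelli :: "nat \<Rightarrow> 'a"
  where "capelli k = (\<Sum>is \<in> index_lists k. minor k (\<lambda>a. is ! (a - 1)) (\<lambda>a. is ! (a - 1)))"

lemma finite_index_lists: "finite (index_lists k)"
  by (rule finite_subset[OF _ finite_lists_length_eq[of "{1..n}" k]]) (auto simp: index_lists_def)

lemma bij_betw_index_list:
  assumes "is \<in> index_lists k"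
  shows "bij_betw (\<lambda>a. is ! (a - 1)) {1..k} (set is)"
proof -
  have "bij_betw (\<lambda>a. a - 1) {1..k} {..<k}"
    by (rule bij_betwI[where g = Suc]) auto
  moreover have "bij_betw ((!) is) {..<k} (set is)"
    using assms strict_sorted_iff by (intro bij_betw_nth) (auto simp: index_lists_def)
  ultimately show ?thesis using bij_betw_trans by (fastforce simp: comp_def)
qed

lemma index_list_in: "is \<in> index_lists k \<Longrightarrow> (\<lambda>a. is ! (a - 1)) \<in> {1..k} \<rightarrow> {1..n}"
  using bij_betw_index_list[of "is" k] bij_betwE
  by (fastforce simp: index_lists_def)

text \<open>An injective function factors uniquely as the increasing enumeration of its image after
  a permutation of the positions. The restriction makes the composite extensional, as
  \<open>index_funs\<close> demands.\<close>

lemma bij_betw_injective_index_funs: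
  "bij_betw (\<lambda>(is, \<pi>). \<lambda>a \<in> {1..k}. is ! (\<pi> a - 1))
     (index_lists k \<times> {\<pi>. \<pi> permutes {1..k}}) {r \<in> index_funs k. inj_on r {1..k}}"
    (is "bij_betw ?g (?L \<times> ?P) ?R")
proof -
  have g: "bij_betw (?g (is, \<pi>)) {1..k} (set is)" if "is \<in> ?L" "\<pi> \<in> ?P" for "is" \<pi>
  proof -
    have "bij_betw ((\<lambda>a. is ! (a - 1)) \<circ> \<pi>) {1..k} (set is)"
      using that permutes_imp_bij bij_betw_index_list bij_betw_trans by blast
    then show ?thesis by (rule bij_betw_cong[THEN iffD1, rotated]) simp
  qed
  show ?thesis
    unfolding bij_betw_def
  proof (intro conjI equalityI subsetI)
    show "inj_on ?g (?L \<times> ?P)"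
    proof (rule inj_onI, clarify)
      fix xs \<pi> ys \<rho>
      assume xs: "xs \<in> ?L" and ys: "ys \<in> ?L"
        and \<pi>: "\<pi> permutes {1..k}" and \<rho>: "\<rho> permutes {1..k}"
        and eq: "(\<lambda>a \<in> {1..k}. xs ! (\<pi> a - 1)) = (\<lambda>a \<in> {1..k}. ys ! (\<rho> a - 1))"
      \<comment> \<open>Equal functions have equal images, and a strictly increasing list is
        determined by its set. The permutations then agree because the list has no
        repetitions.\<close>
      have "set xs = (\<lambda>a \<in> {1..k}. xs ! (\<pi> a - 1)) ` {1..k}"
        using g[OF xs, of \<pi>] \<pi> unfolding case_prod_conv mem_Collect_eq
        by (intro bij_betw_imp_surj_on[symmetric])
      also have "\<dots> = (\<lambda>a \<in> {1..k}. ys ! (\<rho> a - 1)) ` {1..k}"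
        by (rule arg_cong[where f = "\<lambda>h. h ` {1..k}", OF eq])
      also have "\<dots> = set ys"
        using g[OF ys, of \<rho>] \<rho> unfolding case_prod_conv mem_Collect_eq
        by (intro bij_betw_imp_surj_on)
      finally have "set xs = set ys" .
      have "sorted_wrt (<) xs" "sorted_wrt (<) ys"
        using xs ys by (simp_all add: index_lists_def)
      from strict_sorted_equal[OF this(2,1) \<open>set xs = set ys\<close>] have xy: "xs = ys" .
      have "\<pi> a = \<rho> a" for a
      proof (cases "a \<in> {1..k}")
        case True
        then have "xs ! (\<pi> a - 1) = xs ! (\<rho> a - 1)"
          using fun_cong[OF eq, of a] by (simp only: xy restrict_apply if_True)
        moreover have "\<pi> a \<in> {1..k}" "\<rho> a \<in> {1..k}"
          using True by (simp_all only: permutes_in_image[OF \<pi>] permutes_in_image[OF \<rho>])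
        ultimately show ?thesis
          using inj_onD[OF bij_betw_imp_inj_on[OF bij_betw_index_list[OF xs]]] by blast
      next
        case False
        then show ?thesis using \<pi> \<rho> by (metis permutes_not_in)
      qed
      with xy show "xs = ys \<and> \<pi> = \<rho>" by blast
    qed
  next
    fix r assume "r \<in> ?g ` (?L \<times> ?P)"
    then obtain "is" \<pi> where *: "is \<in> ?L" "\<pi> \<in> ?P" "r = ?g (is, \<pi>)" by blast
    then have "set is \<subseteq> {1..n}" "bij_betw r {1..k} (set is)" "r \<in> extensional {1..k}"
      using g[OF *(1,2)] by (auto simp: index_lists_def)
    then show "r \<in> ?R"
      using bij_betw_apply[of r "{1..k}" "set is"]
      by (simp add: index_funs_def PiE_iff bij_betw_imp_inj_on del: atLeastAtMost_iff) blast
  next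
    fix r assume "r \<in> ?R"
    then have r: "r \<in> index_funs k" "inj_on r {1..k}" by auto
    define xs where "xs = sorted_list_of_set (r ` {1..k})"
    let ?s = "\<lambda>a. xs ! (a - 1)"
    have xs: "xs \<in> ?L" "set xs = r ` {1..k}"
      using r by (auto simp: xs_def index_lists_def card_image index_funs_def)
    let ?i = "inv_into {1..k} ?s"
    \<comment> \<open>Outside \<open>{1..k}\<close> the value must be \<open>a\<close> itself, as
      \<open>permutes\<close> requires.\<close>
    define \<pi> where "\<pi> a = (if a \<in> {1..k} then ?i (r a) else a)" for a
    have s: "bij_betw ?s {1..k} (r ` {1..k})" using bij_betw_index_list[OF xs(1)] xs(2) by simp
    have "bij_betw (?i \<circ> r) {1..k} {1..k}"
      using r(2) bij_betw_inv_into[OF s] by (intro bij_betw_trans) (auto simp: inj_on_imp_bij_betw)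
    then have "bij_betw \<pi> {1..k} {1..k}"
      by (rule bij_betw_cong[THEN iffD1, rotated]) (simp add: \<pi>_def)
    then have \<pi>: "\<pi> permutes {1..k}"
      by (rule bij_imp_permutes) (simp only: \<pi>_def if_False)
    have "r = ?g (xs, \<pi>)"
    proof
      fix a show "r a = ?g (xs, \<pi>) a"
      proof (cases "a \<in> {1..k}")
        case True
        then show ?thesis using bij_betw_inv_into_right[OF s, of "r a"] by (simp add: \<pi>_def)
      next
        case False
        then show ?thesis using r(1) by (auto simp: index_funs_def PiE_iff extensional_def)
      qed
    qed
    then show "r \<in> ?g ` (?L \<times> ?P)" using xs(1) \<pi> by blast
  qed
qed

text \<open>Non-injective functions contribute elements of \<open>J\<close>. The injective ones are
  the \<open>k!\<close> rearrangements of each increasing list, whose determinants are congruent by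
  \<open>fixes_minors_permutes\<close>.\<close>

lemma sum_minor_capelli: "(\<Sum>r \<in> index_funs k. minor k r r) - of_nat (fact k) * capelli k \<in> J"
proof -
  let ?P = "{\<pi>. \<pi> permutes {1..k}}" and ?R = "{r \<in> index_funs k. inj_on r {1..k}}"
  let ?m = "\<lambda>is. minor k (\<lambda>a. is ! (a - 1)) (\<lambda>a. is ! (a - 1))"
  let ?g = "\<lambda>(is, \<pi>). \<lambda>a \<in> {1..k}. is ! (\<pi> a - 1)"
  have "(\<Sum>r \<in> index_funs k. minor k r r)
    = (\<Sum>r \<in> ?R. minor k r r) + (\<Sum>r \<in> index_funs k - ?R. minor k r r)"
    using finite_index_funs by (subst add.commute, intro sum.subset_diff) auto
  also have "(\<Sum>r \<in> ?R. minor k r r) = (\<Sum>x \<in> index_lists k \<times> ?P. minor k (?g x) (?g x))"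
    by (rule sum.reindex_bij_betw[OF bij_betw_injective_index_funs, symmetric])
  also have "\<dots> = (\<Sum>is \<in> index_lists k. \<Sum>\<pi> \<in> ?P. minor k (?g (is, \<pi>)) (?g (is, \<pi>)))"
    unfolding sum.cartesian_product by (rule sum.cong) auto
  finally have *: "(\<Sum>r \<in> index_funs k. minor k r r)
    = (\<Sum>is \<in> index_lists k. \<Sum>\<pi> \<in> ?P. minor k (?g (is, \<pi>)) (?g (is, \<pi>)))
      + (\<Sum>r \<in> index_funs k - ?R. minor k r r)" .
  have "of_nat (fact k) * capelli k = (\<Sum>is \<in> index_lists k. \<Sum>\<pi> \<in> ?P. ?m is)"
    by (simp add: capelli_def sum_distrib_left card_permutations)
  then have "(\<Sum>r \<in> index_funs k. minor k r r) - of_nat (fact k) * capelli k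
    = (\<Sum>is \<in> index_lists k. \<Sum>\<pi> \<in> ?P. minor k (?g (is, \<pi>)) (?g (is, \<pi>)) - ?m is)
      + (\<Sum>r \<in> index_funs k - ?R. minor k r r)"
    unfolding * by (simp add: sum_subtractf)
  also have "\<dots> \<in> J"
  proof (intro J_add J_sum)
    fix "is" \<pi> assume "is \<in> index_lists k" "\<pi> \<in> ?P"
    then have "minor k ((\<lambda>a. is ! (a - 1)) \<circ> \<pi>) ((\<lambda>a. is ! (a - 1)) \<circ> \<pi>) - ?m is \<in> J"
      using fixes_minors_permutes[of \<pi> k] index_list_in by (simp add: fixes_minors_def)
    also have "minor k ((\<lambda>a. is ! (a - 1)) \<circ> \<pi>) ((\<lambda>a. is ! (a - 1)) \<circ> \<pi>)
      = minor k (?g (is, \<pi>)) (?g (is, \<pi>))"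
      by (rule minor_cong) simp_all
    finally show "minor k (?g (is, \<pi>)) (?g (is, \<pi>)) - ?m is \<in> J" .
  qed (use minor_not_inj in auto)
  finally show ?thesis .
qed

lemma capelli_in: "capelli k \<in> A"
  unfolding capelli_def by (intro A_sum minor_in index_list_in)

text \<open>The sum over all index functions commutes with \<open>e p q\<close> modulo
  \<open>J\<close> and is congruent to \<open>k!\<close> times \<open>capelli k\<close>;
  \<open>J_cancel\<close> then removes the central factor \<open>k!\<close>.\<close>

lemma commutator_capelli:
  assumes pq: "p \<in> {1..n}" "q \<in> {1..n}"
  shows "e p q * capelli k - capelli k * e p q \<in> J"
proof (rule J_cancel)
  let ?Z = "\<Sum>r \<in> index_funs k. minor k r r" and ?d = "of_nat (fact k) :: 'a"
  have "?d * (e p q * capelli k - capelli k * e p q)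
    = (e p q * ?Z - ?Z * e p q)
      - (e p q * (?Z - ?d * capelli k) - (?Z - ?d * capelli k) * e p q)"
  proof -
    have "d * (x * c - c * x) = (x * z - z * x) - (x * (z - d * c) - (z - d * c) * x)"
      if "d * x = x * d" for d x c z :: 'a
    proof -
      have "d * (x * c) = x * (d * c)" using that by (simp flip: mult.assoc)
      then show ?thesis by (simp add: algebra_simps)
    qed
    then show ?thesis using mult_of_nat_commute by blast
  qed
  also have "\<dots> \<in> J"
    by (rule J_diff[OF commutator_sum_minor[OF pq]
          J_diff[OF J_mult_left[OF e_in[OF pq] sum_minor_capelli]
            J_mult_right[OF sum_minor_capelli e_in[OF pq]]]])
  finally show "?d * (e p q * capelli k - capelli k * e p q) \<in> J" .
qed simp

end

section \<open>The enveloping algebra\<close>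

lemma single_zero_mult_commute:
  "Poly_Mapping.single 0 c * f = f * Poly_Mapping.single 0 (c :: complex)" for f :: free_alg
proof (induction f rule: update_induct)
  case (update f k v)
  have "Poly_Mapping.update k v f = f + Poly_Mapping.single k v"
    using update(1) by (intro poly_mapping_eqI)
      (auto simp: lookup_add lookup_single lookup_update when_def in_keys_iff)
  then show ?case using update by (simp add: algebra_simps mult_single)
qed simp

lemma single_Word_Cons:
  "Poly_Mapping.single (Word ((i, j) # l)) c = free_gen i j * Poly_Mapping.single (Word l) c"
  by (simp add: free_gen_def mult_single plus_word_def)

lemma tensor_gl_single:
  "Poly_Mapping.single 0 c \<in> carrier (tensor_gl n)"
  by (simp add: tensor_gl_def zero_word_def)

lemma gl_ideal_mult_left:
  "a \<in> carrier (tensor_gl n) \<Longrightarrow> x \<in> gl_ideal n \<Longrightarrow> a * x \<in> gl_ideal n"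
  using ideal.I_l_closed[OF ideal_gl_ideal] by (metis tensor_gl_ops(1))

lemma gl_ideal_mult_right:
  "x \<in> gl_ideal n \<Longrightarrow> a \<in> carrier (tensor_gl n) \<Longrightarrow> x * a \<in> gl_ideal n"
  using ideal.I_r_closed[OF ideal_gl_ideal] by (metis tensor_gl_ops(1))

lemma gl_ideal_diff: "x \<in> gl_ideal n \<Longrightarrow> y \<in> gl_ideal n \<Longrightarrow> x - y \<in> gl_ideal n"
  using gl_ideal_add[OF _ gl_ideal_uminus] by (metis diff_conv_add_uminus)

text \<open>The constant 1/m, placed at the empty word, lies in the tensor algebra, and the ideal is
  stable under multiplication by it.\<close>

lemma gl_ideal_cancel:
  assumes "0 < m" "of_nat m * x \<in> gl_ideal n"
  shows "x \<in> gl_ideal n"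
proof -
  have "Poly_Mapping.single 0 (1 / of_nat m) * (of_nat m * x) \<in> gl_ideal n"
    using assms(2) by (rule gl_ideal_mult_left[OF tensor_gl_single])
  also have "Poly_Mapping.single 0 (1 / of_nat m) * (of_nat m * x)
    = Poly_Mapping.single 0 (1 / of_nat m) * Poly_Mapping.single 0 (of_nat m) * x"
    unfolding single_of_nat by (simp only: mult.assoc)
  also have "\<dots> = x"
    unfolding mult_single using assms(1) by simp
  finally show ?thesis .
qed

text \<open>Made for all \<open>n\<close> at once. \<open>shifted\<close> and \<open>minor\<close>
  depend only on the generators, so the determinants for \<open>n\<close> and \<open>n + 1\<close>
  are literally the same elements of the free algebra.\<close>

interpretation gl: gl_mod "carrier (tensor_gl n)" "gl_ideal n" free_gen n for n
proof unfold_locales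
  fix i j p q assume "i \<in> {1..n}" "j \<in> {1..n}" "p \<in> {1..n}" "q \<in> {1..n}"
  then have "free_gen i j * free_gen p q - free_gen p q * free_gen i j
      - ((if j = p then free_gen i q else 0) - (if q = i then free_gen p j else 0)) \<in> gl_relations n"
    unfolding gl_relations_def by blast
  then show "free_gen i j * free_gen p q - free_gen p q * free_gen i j
      - ((if j = p then free_gen i q else 0) - (if q = i then free_gen p j else 0)) \<in> gl_ideal n"
    using ring.genideal_self[OF ring_tensor_gl gl_relations_closed] unfolding gl_ideal_def by blast
qed (use gl_ideal_cancel in \<open>auto intro: tensor_gl_one_closed tensor_gl_minus_closed tensor_gl_mult_closed gl_ideal_zero
   gl_ideal_diff gl_ideal_mult_left gl_ideal_mult_right free_gen_closed\<close>)

text \<open>The Leibniz rule extends commutation from generators to words, and linearity to all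
  elements. The case \<open>m = n\<close> yields centrality; \<open>m = n + 1\<close> shows that
  \<open>U(gl(n))\<close> commutes with the last diagonal unit.\<close>

lemma commutator_gl_ideal:
  assumes z: "z \<in> carrier (tensor_gl m)" and "n \<le> m"
    and gen: "\<And>i j. i \<in> {1..n} \<Longrightarrow> j \<in> {1..n} \<Longrightarrow> free_gen i j * z - z * free_gen i j \<in> gl_ideal m"
    and x: "x \<in> carrier (tensor_gl n)"
  shows "x * z - z * x \<in> gl_ideal m"
proof -
  have word: "Poly_Mapping.single (Word l) c * z - z * Poly_Mapping.single (Word l) c \<in> gl_ideal m
      \<and> Poly_Mapping.single (Word l) c \<in> carrier (tensor_gl m)"
    if "set l \<subseteq> {1..n} \<times> {1..n}" for l c
    using that
  proof (induction l)
    case Nil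
    then show ?case
      using single_zero_mult_commute tensor_gl_single gl_ideal_zero
      by (simp add: zero_word_def[symmetric])
  next
    case (Cons a l)
    then obtain i j where a: "a = (i, j)" "i \<in> {1..n}" "j \<in> {1..n}" by auto
    let ?g = "free_gen i j" and ?w = "Poly_Mapping.single (Word l) c"
    have g: "?g \<in> carrier (tensor_gl m)" using a \<open>n \<le> m\<close> by (intro free_gen_closed) auto
    have w: "?w * z - z * ?w \<in> gl_ideal m" "?w \<in> carrier (tensor_gl m)" using Cons by auto
    have "?g * ?w * z - z * (?g * ?w) = ?g * (?w * z - z * ?w) + (?g * z - z * ?g) * ?w"
      by (simp add: algebra_simps)
    also have "\<dots> \<in> gl_ideal m"
      using gen a g w by (intro gl_ideal_add gl_ideal_mult_left gl_ideal_mult_right)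
    finally show ?case unfolding a(1) single_Word_Cons using tensor_gl_mult_closed[OF g w(2)] by blast
  qed
  have "x = (\<Sum>w \<in> Poly_Mapping.keys x. Poly_Mapping.single w (Poly_Mapping.lookup x w))"
    by (rule poly_mapping_eqI)
      (simp add: lookup_sum lookup_single when_def in_keys_iff sum.delta)
  from arg_cong[OF this, of "\<lambda>y. y * z - z * y"]
  have "x * z - z * x = (\<Sum>w \<in> Poly_Mapping.keys x.
      Poly_Mapping.single w (Poly_Mapping.lookup x w) * z
      - z * Poly_Mapping.single w (Poly_Mapping.lookup x w))"
    by (simp only: sum_distrib_left sum_distrib_right sum_subtractf)
  also have "\<dots> \<in> gl_ideal m"
  proof (rule gl.J_sum)
    fix w assume "w \<in> Poly_Mapping.keys x"
    then have "set (letters w) \<subseteq> {1..n} \<times> {1..n}" using x by (simp add: tensor_gl_def)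
    from word[OF this] show "Poly_Mapping.single w (Poly_Mapping.lookup x w) * z
      - z * Poly_Mapping.single w (Poly_Mapping.lookup x w) \<in> gl_ideal m" by simp
  qed
  finally show ?thesis .
qed

section \<open>Transfer of the operations of \<open>Ugl n\<close> to representatives\<close>

abbreviation gl_class :: "nat \<Rightarrow> free_alg \<Rightarrow> free_alg set"
  where "gl_class n x \<equiv> gl_ideal n +>\<^bsub>tensor_gl n\<^esub> x"

lemma gl_class_closed: "x \<in> carrier (tensor_gl n) \<Longrightarrow> gl_class n x \<in> carrier (Ugl n)"
  by (rule ring_hom_closed[OF Ugl_class_hom])

lemma gl_class_add:
  "x \<in> carrier (tensor_gl n) \<Longrightarrow> y \<in> carrier (tensor_gl n) \<Longrightarrow>
    gl_class n x \<oplus>\<^bsub>Ugl n\<^esub> gl_class n y = gl_class n (x + y)"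
  using ring_hom_add[OF Ugl_class_hom] by (simp add: tensor_gl_ops)

lemma gl_class_mult:
  "x \<in> carrier (tensor_gl n) \<Longrightarrow> y \<in> carrier (tensor_gl n) \<Longrightarrow>
    gl_class n x \<otimes>\<^bsub>Ugl n\<^esub> gl_class n y = gl_class n (x * y)"
  using ring_hom_mult[OF Ugl_class_hom] by (simp add: tensor_gl_ops)

lemma gl_class_one: "\<one>\<^bsub>Ugl n\<^esub> = gl_class n 1"
  using ring_hom_one[OF Ugl_class_hom, of n] by (simp add: tensor_gl_ops)

lemma gl_class_zero: "\<zero>\<^bsub>Ugl n\<^esub> = gl_class n 0"
proof -
  interpret U: ring "Ugl n" by (rule ring_Ugl)
  have "gl_class n 0 \<oplus>\<^bsub>Ugl n\<^esub> gl_class n 0 = gl_class n 0"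
    by (simp add: gl_class_add tensor_gl_zero_closed)
  then show ?thesis
    using U.add.r_cancel_one gl_class_closed[OF tensor_gl_zero_closed] by metis
qed

lemma gl_class_uminus:
  assumes "x \<in> carrier (tensor_gl n)"
  shows "\<ominus>\<^bsub>Ugl n\<^esub> gl_class n x = gl_class n (- x)"
proof -
  interpret U: ring "Ugl n" by (rule ring_Ugl)
  show ?thesis
    using assms by (intro U.minus_equality)
      (simp_all add: gl_class_add gl_class_zero gl_class_closed tensor_gl_uminus_closed)
qed

lemma gl_class_diff:
  "x \<in> carrier (tensor_gl n) \<Longrightarrow> y \<in> carrier (tensor_gl n) \<Longrightarrow>
    gl_class n x \<ominus>\<^bsub>Ugl n\<^esub> gl_class n y = gl_class n (x - y)"
  unfolding a_minus_def
  by (simp add: gl_class_uminus gl_class_add tensor_gl_uminus_closed)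

lemma gl_class_eqI:
  assumes "x - y \<in> gl_ideal n"
  shows "gl_class n x = gl_class n y"
proof -
  have sub: "gl_class n x \<subseteq> gl_class n y" if "x - y \<in> gl_ideal n" for x y
  proof
    fix z assume "z \<in> gl_class n x"
    then obtain h where "h \<in> gl_ideal n" "z = h + x" unfolding a_r_coset_def' tensor_gl_ops by blast
    then have "z = (h + (x - y)) + y" "h + (x - y) \<in> gl_ideal n"
      using that by (auto intro: gl_ideal_add)
    then show "z \<in> gl_class n y" unfolding a_r_coset_def' tensor_gl_ops by blast
  qed
  show ?thesis using sub[OF assms] sub[of y x] gl_ideal_uminus[OF assms] by simp
qed

lemma gl_class_nat_mult:
  assumes "x \<in> carrier (tensor_gl n)"
  shows "[(m :: nat)] \<cdot>\<^bsub>Ugl n\<^esub> gl_class n x = gl_class n (of_nat m * x)"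
proof (induction m)
  interpret U: ring "Ugl n" by (rule ring_Ugl)
  case 0
  show ?case by (simp add: gl_class_zero)
next
  interpret U: ring "Ugl n" by (rule ring_Ugl)
  case (Suc m)
  show ?case
    using Suc assms
    by (simp add: gl_class_add gl.A_of_nat tensor_gl_mult_closed algebra_simps)
qed

lemma gl_class_int_mult:
  assumes "x \<in> carrier (tensor_gl n)"
  shows "[(m :: int)] \<cdot>\<^bsub>Ugl n\<^esub> gl_class n x = gl_class n (of_int m * x)"
proof (cases "0 \<le> m")
  case True
  then show ?thesis
    using gl_class_nat_mult[OF assms, of "nat m"] by (simp add: add_pow_int_ge)
next
  case False
  then show ?thesis
    using gl_class_nat_mult[OF assms, of "nat (- m)"] assms
    by (simp add: add_pow_int_lt gl_class_uminus gl.A_of_nat gl.A_of_int tensor_gl_mult_closed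
        tensor_gl_uminus_closed)
qed

lemma gl_class_sum:
  assumes "finite X" "\<And>i. i \<in> X \<Longrightarrow> f i \<in> carrier (tensor_gl n)"
    "\<And>i. i \<in> X \<Longrightarrow> F i = gl_class n (f i)"
  shows "(\<Oplus>\<^bsub>Ugl n\<^esub>i \<in> X. F i) = gl_class n (\<Sum>i \<in> X. f i)"
  using assms
proof (induction X rule: finite_induct)
  interpret U: ring "Ugl n" by (rule ring_Ugl)
  case empty
  show ?case by (simp add: gl_class_zero)
next
  interpret U: ring "Ugl n" by (rule ring_Ugl)
  case (insert a X)
  have "(\<Oplus>\<^bsub>Ugl n\<^esub>i \<in> insert a X. F i) = F a \<oplus>\<^bsub>Ugl n\<^esub> (\<Oplus>\<^bsub>Ugl n\<^esub>i \<in> X. F i)"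
    using insert.hyps insert.prems gl_class_closed by (intro U.finsum_insert) auto
  also have "\<dots> = gl_class n (f a) \<oplus>\<^bsub>Ugl n\<^esub> gl_class n (\<Sum>i \<in> X. f i)"
    using insert by simp
  finally show ?case
    using insert.hyps insert.prems by (simp add: gl_class_add gl.A_sum)
qed

lemma gl_class_prod_list:
  assumes "\<And>i. i \<in> set xs \<Longrightarrow> f i \<in> carrier (tensor_gl n)"
    "\<And>i. i \<in> set xs \<Longrightarrow> F i = gl_class n (f i)"
  shows "foldr (\<otimes>\<^bsub>Ugl n\<^esub>) (map F xs) \<one>\<^bsub>Ugl n\<^esub> = gl_class n (prod_list (map f xs))"
  using assms
proof (induction xs)
  case Nil
  show ?case by (simp add: gl_class_one)
next
  case (Cons a xs)
  moreover have "prod_list (map f xs) \<in> carrier (tensor_gl n)"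
    using Cons.prems(1) by (intro gl.A_prod_list) auto
  ultimately show ?case by (simp add: gl_class_mult)
qed

lemma cdet_gl_class:
  assumes "\<And>a b. a \<in> {1..k} \<Longrightarrow> b \<in> {1..k} \<Longrightarrow> f a b \<in> carrier (tensor_gl n)"
    "\<And>a b. a \<in> {1..k} \<Longrightarrow> b \<in> {1..k} \<Longrightarrow> F a b = gl_class n (f a b)"
  shows "cdet (Ugl n) k F = gl_class n
    (\<Sum>\<sigma> | \<sigma> permutes {1..k}. of_int (sign \<sigma>) * ordered_prod k (\<lambda>b. f (\<sigma> b) b))"
  unfolding cdet_def
proof (rule gl_class_sum)
  fix \<sigma> assume "\<sigma> \<in> {\<sigma>. \<sigma> permutes {1..k}}"
  then have \<sigma>: "b \<in> {1..k} \<Longrightarrow> \<sigma> b \<in> {1..k}" for b by (simp only: mem_Collect_eq permutes_in_image)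
  have P: "ordered_prod k (\<lambda>b. f (\<sigma> b) b) \<in> carrier (tensor_gl n)"
    using assms(1) \<sigma> by (intro gl.A_ordered_prod) blast
  then show "of_int (sign \<sigma>) * ordered_prod k (\<lambda>b. f (\<sigma> b) b) \<in> carrier (tensor_gl n)"
    by (intro tensor_gl_mult_closed gl.A_of_int)
  have "foldr (\<otimes>\<^bsub>Ugl n\<^esub>) (map (\<lambda>b. F (\<sigma> b) b) [1..<k + 1]) \<one>\<^bsub>Ugl n\<^esub>
      = gl_class n (ordered_prod k (\<lambda>b. f (\<sigma> b) b))"
    unfolding ordered_prod_def
    by (rule gl_class_prod_list; rule assms; (rule \<sigma>)?; auto)
  then show "[sign \<sigma>] \<cdot>\<^bsub>Ugl n\<^esub> foldr (\<otimes>\<^bsub>Ugl n\<^esub>) (map (\<lambda>b. F (\<sigma> b) b) [1..<k + 1]) \<one>\<^bsub>Ugl n\<^esub>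
      = gl_class n (of_int (sign \<sigma>) * ordered_prod k (\<lambda>b. f (\<sigma> b) b))"
    by (simp only: gl_class_int_mult[OF P])
qed (simp add: finite_permutations)

section \<open>\<open>H_gl k n\<close> as a central residue class\<close>

lemma H_gl_class: "H_gl k n = gl_class n (gl.capelli n k)"
  unfolding H_gl_def gl.capelli_def gl.index_lists_def[symmetric]
proof (rule gl_class_sum[OF gl.finite_index_lists])
  fix "is" assume "is": "is \<in> gl.index_lists n k"
  let ?s = "\<lambda>a. is ! (a - 1)"
  let ?f = "\<lambda>a b. gl.shifted (k - b) (?s a) (?s b)"
  show "gl.minor k ?s ?s \<in> carrier (tensor_gl n)"
    using gl.index_list_in[OF "is"] by (intro gl.minor_in)
  show "cdet (Ugl n) k (\<lambda>a b. e_gl n (?s a) (?s b)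
      \<oplus>\<^bsub>Ugl n\<^esub> (if a = b then [(k - a)] \<cdot>\<^bsub>Ugl n\<^esub> \<one>\<^bsub>Ugl n\<^esub> else \<zero>\<^bsub>Ugl n\<^esub>))
    = gl_class n (gl.minor k ?s ?s)"
    unfolding gl.minor_def
  proof (rule cdet_gl_class[where f = ?f])
    fix a b assume ab: "a \<in> {1..k}" "b \<in> {1..k}"
    have s: "?s a \<in> {1..n}" "?s b \<in> {1..n}"
      using gl.index_list_in[OF "is"] ab by blast+
    then show "?f a b \<in> carrier (tensor_gl n)" by (rule gl.shifted_in)
    \<comment> \<open>The list has distinct entries, so equality of labels, used by
      \<open>shifted\<close>, is equality of positions, used by \<open>H_gl\<close>; there
      \<open>k - a\<close> and \<open>k - b\<close> coincide.\<close>
    have "?s a = ?s b \<longleftrightarrow> a = b"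
      using inj_on_eq_iff[OF bij_betw_imp_inj_on[OF gl.bij_betw_index_list[OF "is"]] ab] .
    then show "e_gl n (?s a) (?s b)
      \<oplus>\<^bsub>Ugl n\<^esub> (if a = b then [(k - a)] \<cdot>\<^bsub>Ugl n\<^esub> \<one>\<^bsub>Ugl n\<^esub> else \<zero>\<^bsub>Ugl n\<^esub>) = gl_class n (?f a b)"
      using free_gen_closed[OF s]
      by (cases "a = b")
        (simp_all add: e_gl_def gl.shifted_def gl_class_one gl_class_zero gl_class_nat_mult
          tensor_gl_one_closed tensor_gl_zero_closed gl_class_add gl.A_of_nat)
  qed
qed

lemma H_gl_central: "H_gl k n \<in> zeta_gl n"
  unfolding zeta_gl_def ring_centralizer_def H_gl_class
proof (intro CollectI conjI ballI)
  let ?h = "gl.capelli n k"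
  have h: "?h \<in> carrier (tensor_gl n)" by (rule gl.capelli_in)
  then show "gl_class n ?h \<in> carrier (Ugl n)" by (rule gl_class_closed)
  fix X assume "X \<in> carrier (Ugl n)"
  then obtain x where x: "x \<in> carrier (tensor_gl n)" "X = gl_class n x" by (rule Ugl_cases)
  have "x * ?h - ?h * x \<in> gl_ideal n"
    using commutator_gl_ideal[OF h order_refl gl.commutator_capelli x(1)] .
  from gl_class_eqI[OF this]
  show "gl_class n ?h \<otimes>\<^bsub>Ugl n\<^esub> X = X \<otimes>\<^bsub>Ugl n\<^esub> gl_class n ?h"
    by (simp add: x gl_class_mult h)
qed

section \<open>The component in the left ideal\<close>

lemma Ugl_incl_commutes:
  assumes "X \<in> carrier (Ugl n)"
  shows "Ugl_incl n X \<otimes>\<^bsub>Ugl (n + 1)\<^esub> e_gl (n + 1) (n + 1) (n + 1)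
    = e_gl (n + 1) (n + 1) (n + 1) \<otimes>\<^bsub>Ugl (n + 1)\<^esub> Ugl_incl n X"
proof -
  obtain x where x: "x \<in> carrier (tensor_gl n)" "X = gl_class n x" using assms by (rule Ugl_cases)
  let ?g = "free_gen (n + 1) (n + 1)"
  have g: "?g \<in> carrier (tensor_gl (n + 1))" by (rule free_gen_closed) simp_all
  \<comment> \<open>The bracket vanishes because \<open>n + 1\<close> differs from both
    \<open>i\<close> and \<open>j\<close>.\<close>
  have "free_gen i j * ?g - ?g * free_gen i j \<in> gl_ideal (n + 1)"
    if "i \<in> {1..n}" "j \<in> {1..n}" for i j
    using gl.e_rel[of i "n + 1" j "n + 1" "n + 1"] that by simp
  from commutator_gl_ideal[OF g _ this x(1)]
  have "x * ?g - ?g * x \<in> gl_ideal (n + 1)" by simp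
  from gl_class_eqI[OF this] show ?thesis
    using x tensor_gl_mono g by (simp add: e_gl_def Ugl_incl_coset gl_class_mult subset_iff)
qed

lemma left_ideal_class_sum:
  assumes "left_ideal I (Ugl n)" "finite X" "\<And>i. i \<in> X \<Longrightarrow> f i \<in> carrier (tensor_gl n)"
    "\<And>i. i \<in> X \<Longrightarrow> gl_class n (f i) \<in> I"
  shows "gl_class n (\<Sum>i \<in> X. f i) \<in> I"
  using assms(2-4)
proof (induction X rule: finite_induct)
  have I: "additive_subgroup I (Ugl n)" using assms(1) by (simp add: left_ideal_def)
  case empty
  show ?case using additive_subgroup.zero_closed[OF I] by (simp add: gl_class_zero)
next
  have I: "additive_subgroup I (Ugl n)" using assms(1) by (simp add: left_ideal_def)
  case (insert a X)
  then have "gl_class n (f a) \<oplus>\<^bsub>Ugl n\<^esub> gl_class n (\<Sum>i \<in> X. f i) \<in> I"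
    by (intro additive_subgroup.a_closed[OF I]) auto
  then show ?case using insert by (simp add: gl_class_add gl.A_sum)
qed

text \<open>\<open>m\<close> is the largest admissible entry and the list is increasing. List
  positions start at 0, so \<open>k - 1\<close> is column \<open>k\<close>, whose shift is
  0.\<close>

lemma last_index_list:
  assumes "is \<in> gl.index_lists m k" "m \<in> set is"
  shows "is ! (k - 1) = m"
proof -
  from assms obtain i where i: "i < k" "is ! i = m" by (auto simp: gl.index_lists_def in_set_conv_nth)
  have "is ! (k - 1) \<in> set is" using assms i by (auto simp: gl.index_lists_def)
  then have "is ! (k - 1) \<le> m" using assms by (auto simp: gl.index_lists_def)
  moreover have "is ! i < is ! (k - 1)" if "i < k - 1"
    using assms that i sorted_wrt_nth_less[of "(<)" "is" i "k - 1"] by (auto simp: gl.index_lists_def)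
  ultimately have "i = k - 1" using i by fastforce
  with i show ?thesis by simp
qed

text \<open>The shift of the last column vanishes, so each summand ends in some \<open>e\<^bsub>i,m\<^esub>\<close>.\<close>

lemma minor_last_column_in_I_left:
  assumes k: "1 \<le> k" and "is": "is \<in> gl.index_lists m k" "m \<in> set is"
  shows "gl_class m (gl.minor k (\<lambda>a. is ! (a - 1)) (\<lambda>a. is ! (a - 1))) \<in> I_left m"
  unfolding I_left_def gen_left_ideal_def
proof (intro InterI, elim CollectE conjE)
  fix I assume I: "left_ideal I (Ugl m)" "{e_gl m i m |i. i \<in> {1..m}} \<subseteq> I"
  let ?s = "\<lambda>a. is ! (a - 1)"
  have s: "?s a \<in> {1..m}" if "a \<in> {1..k}" for a
    using gl.index_list_in[OF "is"(1)] that by blast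
  obtain k' where k': "k = Suc k'" using k by (cases k) auto
  show "gl_class m (gl.minor k ?s ?s) \<in> I"
    unfolding gl.minor_def
  proof (rule left_ideal_class_sum[OF I(1)])
    fix \<sigma> assume "\<sigma> \<in> {\<sigma>. \<sigma> permutes {1..k}}"
    then have \<sigma>: "b \<in> {1..k} \<Longrightarrow> \<sigma> b \<in> {1..k}" for b by (simp only: mem_Collect_eq permutes_in_image)
    let ?T = "\<lambda>b. gl.shifted (k - b) (?s (\<sigma> b)) (?s b)"
    let ?u = "of_int (sign \<sigma>) * ordered_prod k' ?T" and ?i = "?s (\<sigma> k)"
    have T: "?T b \<in> carrier (tensor_gl m)" if "b \<in> {1..k}" for b
      using that by (intro gl.shifted_in s \<sigma>)
    have i: "?i \<in> {1..m}" "m \<in> {1..m}" using k s[OF \<sigma>, of k] by auto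
    have u: "?u \<in> carrier (tensor_gl m)"
      using T k' by (intro tensor_gl_mult_closed gl.A_of_int gl.A_ordered_prod) auto
    \<comment> \<open>The last factor has shift \<open>k - k\<close> and column label
      \<open>m\<close>, so it is a bare generator. All other factors stand to its left, as
      membership in a left ideal needs.\<close>
    have eq: "of_int (sign \<sigma>) * ordered_prod k ?T = ?u * free_gen ?i m"
      using last_index_list[OF "is"] by (simp add: k' gl.shifted_def mult.assoc)
    show "of_int (sign \<sigma>) * ordered_prod k ?T \<in> carrier (tensor_gl m)"
      unfolding eq by (intro tensor_gl_mult_closed u free_gen_closed i)
    have "gl_class m (of_int (sign \<sigma>) * ordered_prod k ?T) = gl_class m ?u \<otimes>\<^bsub>Ugl m\<^esub> e_gl m ?i m"
      unfolding eq e_gl_def by (rule gl_class_mult[OF u free_gen_closed[OF i], symmetric])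
    moreover have "e_gl m ?i m \<in> I" using I(2) i by blast
    ultimately show "gl_class m (of_int (sign \<sigma>) * ordered_prod k ?T) \<in> I"
      using I(1) gl_class_closed[OF u] by (auto simp: left_ideal_def)
  qed (simp add: finite_permutations)
qed

text \<open>The lists with entries up to \<open>n\<close> are those with entries up to
  \<open>n + 1\<close> that avoid \<open>n + 1\<close>, and their summands coincide, so the
  difference is an equality in the free algebra.\<close>

lemma capelli_Suc_diff:
  "gl.capelli (n + 1) k - gl.capelli n k
    = (\<Sum>is | is \<in> gl.index_lists (n + 1) k \<and> n + 1 \<in> set is.
        gl.minor k (\<lambda>a. is ! (a - 1)) (\<lambda>a. is ! (a - 1)))"
proof -
  let ?L = "gl.index_lists (n + 1) k"
  have "gl.index_lists n k \<subseteq> ?L" "{is. is \<in> ?L \<and> n + 1 \<in> set is} = ?L - gl.index_lists n k"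
    by (auto simp: gl.index_lists_def subset_iff le_Suc_eq)
  then show ?thesis
    unfolding gl.capelli_def using gl.finite_index_lists by (simp only: sum_diff)
qed

lemma (in ring) ring_centralizer_minus:
  assumes "S \<subseteq> carrier R" "x \<in> ring_centralizer R S" "y \<in> ring_centralizer R S"
  shows "x \<ominus> y \<in> ring_centralizer R S"
  using assms
  by (auto simp: ring_centralizer_def a_minus_def l_distr r_distr l_minus r_minus subset_iff)

lemma (in abelian_group) add_minus_cancel:
  "x \<in> carrier G \<Longrightarrow> y \<in> carrier G \<Longrightarrow> y \<oplus> (x \<ominus> y) = x"
  by (simp add: a_minus_def a_lcomm r_neg)

theorem proposition5p6:
  fixes n k :: nat
  assumes "n \<ge> 1" and "1 \<le> k" and "k \<le> n"
  shows "olshanski_decomposition n (H_gl k (n + 1)) (H_gl k n)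
           (H_gl k (n + 1) \<ominus>\<^bsub>Ugl (n + 1)\<^esub> Ugl_incl n (H_gl k n))"
proof -
  interpret U: ring "Ugl (n + 1)" by (rule ring_Ugl)
  let ?H = "H_gl k (n + 1)" and ?H' = "Ugl_incl n (H_gl k n)" and ?e = "e_gl (n + 1) (n + 1) (n + 1)"
  have h: "gl.capelli (n + 1) k \<in> carrier (tensor_gl (n + 1))"
    "gl.capelli n k \<in> carrier (tensor_gl (n + 1))"
    using gl.capelli_in tensor_gl_mono by blast+
  have H': "?H' = gl_class (n + 1) (gl.capelli n k)"
    unfolding H_gl_class by (rule Ugl_incl_coset[OF gl.capelli_in])
  have closed: "?H \<in> carrier (Ugl (n + 1))" "?H' \<in> carrier (Ugl (n + 1))"
    unfolding H' unfolding H_gl_class by (intro gl_class_closed h)+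
  have e: "?e \<in> carrier (Ugl (n + 1))"
    unfolding e_gl_def by (intro gl_class_closed free_gen_closed) simp_all
  \<comment> \<open>\<open>?H\<close> commutes with \<open>?e\<close> by centrality,
    \<open>?H'\<close> because it comes from \<open>U(gl(n))\<close>; hence so does their
    difference.\<close>
  have "?H \<otimes>\<^bsub>Ugl (n + 1)\<^esub> ?e = ?e \<otimes>\<^bsub>Ugl (n + 1)\<^esub> ?H"
    using H_gl_central[of k "n + 1"] e by (simp add: zeta_gl_def ring_centralizer_def)
  moreover have "?H' \<otimes>\<^bsub>Ugl (n + 1)\<^esub> ?e = ?e \<otimes>\<^bsub>Ugl (n + 1)\<^esub> ?H'"
    by (rule Ugl_incl_commutes) (simp add: H_gl_class gl_class_closed gl.capelli_in)
  ultimately have "?H \<ominus>\<^bsub>Ugl (n + 1)\<^esub> ?H' \<in> Ugl_zero (n + 1)"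
    unfolding Ugl_zero_def using closed e
    by (intro U.ring_centralizer_minus) (simp_all add: ring_centralizer_def)
  \<comment> \<open>The difference is the class of the sum of determinants over index sets
    containing \<open>n + 1\<close>. Each of them lies in every left ideal containing the generators
    of \<open>I_left\<close>.\<close>
  moreover have "?H \<ominus>\<^bsub>Ugl (n + 1)\<^esub> ?H' \<in> I_left (n + 1)"
    unfolding H' unfolding H_gl_class gl_class_diff[OF h] capelli_Suc_diff I_left_def gen_left_ideal_def
  proof (intro InterI, elim CollectE conjE)
    fix I assume I: "left_ideal I (Ugl (n + 1))" "{e_gl (n + 1) i (n + 1) |i. i \<in> {1..n + 1}} \<subseteq> I"
    show "gl_class (n + 1) (\<Sum>is | is \<in> gl.index_lists (n + 1) k \<and> n + 1 \<in> set is.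
        gl.minor k (\<lambda>a. is ! (a - 1)) (\<lambda>a. is ! (a - 1))) \<in> I"
    proof (rule left_ideal_class_sum[OF I(1)])
      fix "is" assume "is \<in> {is. is \<in> gl.index_lists (n + 1) k \<and> n + 1 \<in> set is}"
      then have "is": "is \<in> gl.index_lists (n + 1) k" "n + 1 \<in> set is" by simp_all
      show "gl.minor k (\<lambda>a. is ! (a - 1)) (\<lambda>a. is ! (a - 1)) \<in> carrier (tensor_gl (n + 1))"
        using gl.index_list_in[OF "is"(1)] by (intro gl.minor_in)
      show "gl_class (n + 1) (gl.minor k (\<lambda>a. is ! (a - 1)) (\<lambda>a. is ! (a - 1))) \<in> I"
        using minor_last_column_in_I_left[OF assms(2) "is"] I
        unfolding I_left_def gen_left_ideal_def by blast
    qed (use gl.finite_index_lists in auto)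
  qed
  ultimately have "?H \<ominus>\<^bsub>Ugl (n + 1)\<^esub> ?H' \<in> I_zero (n + 1)" by (simp add: I_zero_def)
  moreover have "?H = ?H' \<oplus>\<^bsub>Ugl (n + 1)\<^esub> (?H \<ominus>\<^bsub>Ugl (n + 1)\<^esub> ?H')"
    by (rule U.add_minus_cancel[OF closed, symmetric])
  ultimately show ?thesis
    unfolding olshanski_decomposition_def using H_gl_central by blast
qed

end
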